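(* Let $A$ denote an arbitrary right-angled Artin group. If elements $x,y,z\in A$ satisfy the relation $x^2y^2=z^2$ in $A$, then $x$, $y$ and $z$ are mutually commuting elements, i.e. $xy=yx$, $xz=zx$ and $yz=zy$.
   Context: For a finite simple graph $\Delta$ (no loops or multiple edges) with vertex set $\mathcal V$ and edge set $\mathcal E$, the associated right-angled Artin group is $A_\Delta=\langle\mathcal V\mid uv=vu\text{ if }(u,v)\in\mathcal E\rangle$. A right-angled Artin group is any group of this form. *)

theory Defs
  imports "HOL-Algebra.Group" "Graph_Theory.Pair_Digraph"
begin

text \<open>The letter \<open>(s, True)\<close> stands for the generator \<open>s\<close>, and \<open>(s, False)\<close> for its formal inverse.\<close>

type_synonym 's word = "('s \<times> bool) list"

abbreviation words :: "'s set \<Rightarrow> 's word set" where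
  "words S \<equiv> lists (S \<times> UNIV)"

text \<open>
  Equality of words in the group \<open>\<langle>S | R\<rangle>\<close>: the smallest congruence on the monoid of words over
  \<open>S\<close> and its formal inverses that cancels adjacent inverse letters and identifies \<open>l\<close> with \<open>r\<close>
  for every defining relation \<open>l = r\<close>, encoded as the pair \<open>(l, r) \<in> R\<close>.
\<close>

inductive_set word_eq :: "'s set \<Rightarrow> ('s word \<times> 's word) set \<Rightarrow> ('s word \<times> 's word) set"
  for S :: "'s set" and R :: "('s word \<times> 's word) set" where
  word_eq_refl: "w \<in> words S \<Longrightarrow> (w, w) \<in> word_eq S R"
| word_eq_sym: "(u, v) \<in> word_eq S R \<Longrightarrow> (v, u) \<in> word_eq S R"
| word_eq_trans: "(u, v) \<in> word_eq S R \<Longrightarrow> (v, w) \<in> word_eq S R \<Longrightarrow> (u, w) \<in> word_eq S R"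
| word_eq_append: "(u, u') \<in> word_eq S R \<Longrightarrow> (v, v') \<in> word_eq S R \<Longrightarrow> (u @ v, u' @ v') \<in> word_eq S R"
| word_eq_cancel: "s \<in> S \<Longrightarrow> ([(s, b), (s, \<not> b)], []) \<in> word_eq S R"
| word_eq_relation: "(l, r) \<in> R \<Longrightarrow> l \<in> words S \<Longrightarrow> r \<in> words S \<Longrightarrow> (l, r) \<in> word_eq S R"

definition presented_group :: "'s set \<Rightarrow> ('s word \<times> 's word) set \<Rightarrow> 's word set monoid" where
  "presented_group S R =
    \<lparr>carrier = words S // word_eq S R,
     monoid.mult = (\<lambda>X Y. \<Union>u\<in>X. \<Union>v\<in>Y. word_eq S R `` {u @ v}),
     monoid.one = word_eq S R `` {[]}\<rparr>"

definition RAAG :: "'v pair_pre_digraph \<Rightarrow> 'v word set monoid" where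
  "RAAG \<Delta> = presented_group (pverts \<Delta>)
     {([(u, True), (v, True)], [(v, True), (u, True)]) | u v. (u, v) \<in> parcs \<Delta>}"

lemma word_eq_words:
  assumes "(u, v) \<in> word_eq S R"
  shows "u \<in> words S" "v \<in> words S"
  using assms by (induction rule: word_eq.induct) auto

lemma equiv_word_eq: "equiv (words S) (word_eq S R)"
proof (rule equivI)
  show "word_eq S R \<subseteq> words S \<times> words S"
    using word_eq_words by fast
  show "refl_on (words S) (word_eq S R)"
    by (rule refl_onI) (rule word_eq_refl)
  show "sym (word_eq S R)"
    by (rule symI) (rule word_eq_sym)
  show "trans (word_eq S R)"
    by (rule transI) (rule word_eq_trans)
qed

lemma presented_group_mult:
  assumes "u \<in> words S" "v \<in> words S"
  shows "word_eq S R `` {u} \<otimes>\<^bsub>presented_group S R\<^esub> word_eq S R `` {v} = word_eq S R `` {u @ v}"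
proof -
  have "word_eq S R `` {u' @ v'} = word_eq S R `` {u @ v}"
    if "u' \<in> word_eq S R `` {u}" "v' \<in> word_eq S R `` {v}" for u' v'
    using that equiv_class_eq[OF equiv_word_eq] by (metis Image_singleton_iff word_eq_append)
  moreover have "u \<in> word_eq S R `` {u}" "v \<in> word_eq S R `` {v}"
    using word_eq_refl[OF assms(1)] word_eq_refl[OF assms(2)] by simp_all
  ultimately have "(\<Union>u'\<in>word_eq S R `` {u}. \<Union>v'\<in>word_eq S R `` {v}. word_eq S R `` {u' @ v'}) =
      word_eq S R `` {u @ v}"
    by blast
  then show ?thesis
    by (simp add: presented_group_def)
qed

lemma inverse_in_words:
  assumes "w \<in> words S"
  shows "rev (map (apsnd Not) w) \<in> words S"
  using assms by fastforce

lemma word_inverse: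
  assumes "w \<in> words S"
  shows "(rev (map (apsnd Not) w) @ w, []) \<in> word_eq S R"
  using assms
proof (induction rule: lists.induct)
  case Nil
  then show ?case by (simp add: word_eq_refl)
next
  case (Cons a w)
  obtain s b where a: "a = (s, b)" by (cases a)
  have s: "s \<in> S" and w: "w \<in> words S" using Cons.hyps unfolding a by simp_all
  let ?i = "rev (map (apsnd Not) w)"
  have i: "?i \<in> words S" using w by (rule inverse_in_words)
  have "([(s, \<not> b), (s, b)], []) \<in> word_eq S R"
    using word_eq_cancel[OF s, of "\<not> b"] by simp
  from word_eq_append[OF word_eq_append[OF word_eq_refl[OF i] this] word_eq_refl[OF w]]
  have "(?i @ [(s, \<not> b), (s, b)] @ w, ?i @ w) \<in> word_eq S R" by simp
  from word_eq_trans[OF this Cons.IH] show ?case using a w by simp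
qed

lemma group_presented_group: "group (presented_group S R)"
proof (rule groupI)
  let ?G = "presented_group S R"
  have carr: "X \<in> carrier ?G \<longleftrightarrow> (\<exists>w\<in>words S. X = word_eq S R `` {w})" for X
    by (auto simp: presented_group_def quotient_def)
  have one: "\<one>\<^bsub>?G\<^esub> = word_eq S R `` {[]}"
    by (simp add: presented_group_def)
  show "\<one>\<^bsub>?G\<^esub> \<in> carrier ?G"
    unfolding carr one by (rule bexI[of _ "[]"]) auto
  fix X assume "X \<in> carrier ?G"
  then obtain u where u: "u \<in> words S" "X = word_eq S R `` {u}" unfolding carr by blast
  show "\<one>\<^bsub>?G\<^esub> \<otimes>\<^bsub>?G\<^esub> X = X"
    unfolding one u(2) using presented_group_mult[of "[]" S u] u(1) by simp
  have "word_eq S R `` {rev (map (apsnd Not) u)} \<in> carrier ?G"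
    unfolding carr using inverse_in_words[OF u(1)] by blast
  moreover have "word_eq S R `` {rev (map (apsnd Not) u)} \<otimes>\<^bsub>?G\<^esub> X = \<one>\<^bsub>?G\<^esub>"
    unfolding one u(2) presented_group_mult[OF inverse_in_words[OF u(1)] u(1)]
    by (rule equiv_class_eq[OF equiv_word_eq word_inverse[OF u(1)]])
  ultimately show "\<exists>Y\<in>carrier ?G. Y \<otimes>\<^bsub>?G\<^esub> X = \<one>\<^bsub>?G\<^esub>" by blast
  fix Y assume "Y \<in> carrier ?G"
  then obtain v where v: "v \<in> words S" "Y = word_eq S R `` {v}" unfolding carr by blast
  have uv: "u @ v \<in> words S" using u(1) v(1) by auto
  show "X \<otimes>\<^bsub>?G\<^esub> Y \<in> carrier ?G"
    unfolding u(2) v(2) presented_group_mult[OF u(1) v(1)] carr using uv by blast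
  fix Z assume "Z \<in> carrier ?G"
  then obtain w where w: "w \<in> words S" "Z = word_eq S R `` {w}" unfolding carr by blast
  have vw: "v @ w \<in> words S" using v(1) w(1) by auto
  show "X \<otimes>\<^bsub>?G\<^esub> Y \<otimes>\<^bsub>?G\<^esub> Z = X \<otimes>\<^bsub>?G\<^esub> (Y \<otimes>\<^bsub>?G\<^esub> Z)"
    by (simp only: u(2) v(2) w(2) presented_group_mult u(1) v(1) w(1) uv vw append_assoc)
qed

end

theory Submission
  imports Defs "HOL-Algebra.Group_Action" "HOL-Library.Sublist"
begin

text \<open>
  Put \<open>t = (xy)\<inverse>z\<close>.  The relation \<open>x\<^sup>2y\<^sup>2 = z\<^sup>2\<close> is equivalent to \<open>t\<^sup>2 = [ty\<inverse>, xy]\<close>; these are two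
  presentations of the fundamental group of the closed non-orientable surface of Euler characteristic
  \<open>-1\<close>.  It is therefore enough to show that in a right-angled Artin group only the trivial element \<open>t\<close>
  has a commutator as its square: then \<open>z = xy\<close>, hence \<open>x\<^sup>2y\<^sup>2 = xyxy\<close> and \<open>xy = yx\<close> (lemma
  \<open>squares_commute\<close>).  Geometrically, \<open>t\<close> is the one-sided curve with orientable complement, and every
  two-sided simple closed curve on this surface can be made disjoint from it unless that curve bounds
  a Moebius band; this suggests that \<open>t\<close> has a fixed point whenever the surface group acts on a
  tree without interchanging two vertices.

  For the combinatorial proof of this (\<open>square_commutator_fixes_point\<close>), let \<open>t\<^sup>2 = [a, b]\<close>.  If \<open>a\<close> has a
  fixed point, then \<open>[a, b]\<close> is a product of two elements with fixed points.  If their fixed point sets are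
  disjoint, \<open>t\<close> shifts the axis of the product by half its translation length, and composing \<open>t\<close> with \<open>a\<close>
  gives an element that interchanges the ends of the bridge between the two sets.  In general, choose
  \<open>a\<close>, \<open>b\<close> and a base point with the sum of the displacements as small as possible, among all pairs whose
  commutator is the square of an element without fixed points.  The Nielsen moves then bound the
  cancellation in \<open>aba\<inverse>b\<inverse>\<close>, so that the axis of the commutator is known.  Each of the segments of \<open>a\<close> and
  \<open>b\<close> occurs twice on it, in opposite directions and half a period apart, so that once more
  composition with \<open>t\<close> interchanges two vertices (\<open>interchanged_on_axis\<close>), unless these segments are
  trivial, and then \<open>ab\<inverse>\<close> has a fixed point.

  The theorem follows by induction on the number of vertices.  Let \<open>A\<close> arise from \<open>B\<close> by adding the vertex
  \<open>v\<close>.  Then \<open>A\<close> acts on the Bass--Serre tree of the HNN extension with stable letter \<open>v\<close>, which is the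
  Cayley tree of the free group on the conjugates of \<open>v\<close> by elements of \<open>B\<close>.  That no element interchanges
  two vertices comes down to the uniqueness of square roots in \<open>B\<close>
  (\<open>action_fixes_if_square_fixes\<close>), which is a case of the induction hypothesis
  (\<open>square_root_unique\<close>).  So \<open>t\<close> is conjugate into \<open>B\<close>, and the retraction of \<open>A\<close> onto \<open>B\<close> reduces the
  claim to the induction hypothesis.
\<close>

section \<open>Words in a group\<close>

context group
begin

lemma inv_mult_cancel:
  assumes "x \<in> carrier G" "y \<in> carrier G"
  shows "inv x \<otimes> (x \<otimes> y) = y" "x \<otimes> (inv x \<otimes> y) = y"
  using assms by (simp_all flip: m_assoc)

text \<open>Rewriting with these rules brings a word in group elements into freely reduced form.\<close>

lemmas free_reduce = m_assoc inv_mult_group inv_mult_cancel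

lemma subgroup_commuting:
  assumes v: "v \<in> carrier G"
  shows "subgroup {g \<in> carrier G. g \<otimes> v = v \<otimes> g} G"
proof (rule subgroupI)
  show "{g \<in> carrier G. g \<otimes> v = v \<otimes> g} \<noteq> {}" using v by (auto intro: exI[of _ \<one>])
next
  fix g assume "g \<in> {g \<in> carrier G. g \<otimes> v = v \<otimes> g}"
  then have g: "g \<in> carrier G" and comm: "g \<otimes> v = v \<otimes> g" by auto
  have "inv g \<otimes> (g \<otimes> v) \<otimes> inv g = inv g \<otimes> (v \<otimes> g) \<otimes> inv g" by (simp only: comm)
  then show "inv g \<in> {g \<in> carrier G. g \<otimes> v = v \<otimes> g}" using g v by (simp add: free_reduce)
next
  fix g h assume "g \<in> {g \<in> carrier G. g \<otimes> v = v \<otimes> g}" "h \<in> {g \<in> carrier G. g \<otimes> v = v \<otimes> g}"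
  then have gh: "g \<in> carrier G" "h \<in> carrier G" and comm: "g \<otimes> v = v \<otimes> g" "h \<otimes> v = v \<otimes> h" by auto
  have "g \<otimes> h \<otimes> v = g \<otimes> (v \<otimes> h)" using gh v by (simp only: m_assoc comm(2))
  also have "\<dots> = v \<otimes> (g \<otimes> h)" using gh v comm(1) by (simp flip: m_assoc)
  finally show "g \<otimes> h \<in> {g \<in> carrier G. g \<otimes> v = v \<otimes> g}" using gh by simp
qed auto

end

section \<open>Commutators that are squares\<close>

text \<open>This is the property that is carried through the induction on the vertices.  It implies the
  statement about \<open>x\<^sup>2y\<^sup>2 = z\<^sup>2\<close> and the uniqueness of square roots, and the induction step needs
  both itself and the unique square roots for the smaller group.\<close>

definition no_square_commutator :: "('a, 'b) monoid_scheme \<Rightarrow> bool" where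
  "no_square_commutator G \<longleftrightarrow> (\<forall>a\<in>carrier G. \<forall>b\<in>carrier G. \<forall>t\<in>carrier G.
    t \<otimes>\<^bsub>G\<^esub> t = a \<otimes>\<^bsub>G\<^esub> b \<otimes>\<^bsub>G\<^esub> inv\<^bsub>G\<^esub> a \<otimes>\<^bsub>G\<^esub> inv\<^bsub>G\<^esub> b \<longrightarrow> t = \<one>\<^bsub>G\<^esub>)"

context group
begin

text \<open>If \<open>h\<^sup>2 = k\<^sup>2\<close>, then \<open>h\<close> conjugates \<open>s = k\<inverse>h\<close> to its inverse, which is the relation of a Klein
  bottle, and \<open>s\<^sup>2\<close> is the commutator of \<open>h\<close> and \<open>s\<inverse>\<close>.\<close>

lemma square_root_unique:
  assumes "no_square_commutator G" and G: "h \<in> carrier G" "k \<in> carrier G" and eq: "h \<otimes> h = k \<otimes> k"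
  shows "h = k"
proof -
  let ?s = "inv k \<otimes> h" and ?t = "inv h \<otimes> k"
  have k: "inv k \<otimes> h = k \<otimes> inv h"
  proof -
    have "inv k \<otimes> (h \<otimes> h) \<otimes> inv h = inv k \<otimes> (k \<otimes> k) \<otimes> inv h" using eq by simp
    then show ?thesis using G by (simp add: free_reduce)
  qed
  have "h \<otimes> ?t \<otimes> inv h \<otimes> inv ?t = (k \<otimes> inv h) \<otimes> (inv k \<otimes> h)"
    using G by (simp add: free_reduce)
  then have "?s \<otimes> ?s = h \<otimes> ?t \<otimes> inv h \<otimes> inv ?t" by (simp flip: k)
  moreover have "?s \<in> carrier G" "?t \<in> carrier G" using G by simp_all
  ultimately have "?s = \<one>" using assms(1) G unfolding no_square_commutator_def by blast
  then have "k \<otimes> ?s = k" using G by simp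
  then show ?thesis using G by (simp add: free_reduce)
qed

text \<open>Put \<open>t = (xy)\<inverse>z\<close>.  The relation \<open>x\<^sup>2y\<^sup>2 = z\<^sup>2\<close> is equivalent to \<open>t\<^sup>2 = [ty\<inverse>, xy]\<close>, and it reads
  \<open>x\<^sup>2y\<^sup>2 = (xy)\<^sup>2\<close> once \<open>t = 1\<close> is known.\<close>

lemma squares_commute:
  assumes "no_square_commutator G" and G: "x \<in> carrier G" "y \<in> carrier G" "z \<in> carrier G"
    and eq: "(x \<otimes> x) \<otimes> (y \<otimes> y) = z \<otimes> z"
  shows "x \<otimes> y = y \<otimes> x" "x \<otimes> z = z \<otimes> x" "y \<otimes> z = z \<otimes> y"
proof -
  let ?m = "x \<otimes> y"
  let ?t = "inv ?m \<otimes> z"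
  let ?a = "?t \<otimes> inv y"
  have m: "?m \<in> carrier G" "?t \<in> carrier G" "?a \<in> carrier G" using G by simp_all
  have z: "z = ?m \<otimes> ?t" using G by (simp add: free_reduce)
  have "inv x \<otimes> ((x \<otimes> x) \<otimes> (y \<otimes> y)) = inv x \<otimes> (z \<otimes> z)" using eq by simp
  then have "x \<otimes> (y \<otimes> y) = inv x \<otimes> (z \<otimes> z)" using G by (simp add: free_reduce)
  have "?a \<otimes> ?m \<otimes> inv ?a \<otimes> inv ?m = ?t \<otimes> (inv y \<otimes> (x \<otimes> (y \<otimes> y))) \<otimes> inv ?t \<otimes> inv ?m"
    using G m by (simp add: m_assoc inv_mult_group)
  also have "\<dots> = ?t \<otimes> (inv y \<otimes> (inv x \<otimes> (z \<otimes> z))) \<otimes> inv ?t \<otimes> inv ?m"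
    using \<open>x \<otimes> (y \<otimes> y) = _\<close> by simp
  also have "\<dots> = ?t \<otimes> ?t" using G by (simp add: free_reduce)
  finally have "?t = \<one>" using assms(1) m unfolding no_square_commutator_def by metis
  then have zm: "z = ?m" using z m by simp
  have "inv x \<otimes> ((x \<otimes> x) \<otimes> (y \<otimes> y)) \<otimes> inv y = inv x \<otimes> (?m \<otimes> ?m) \<otimes> inv y" using eq zm by simp
  then show xy: "x \<otimes> y = y \<otimes> x" using G by (simp add: free_reduce)
  show "x \<otimes> z = z \<otimes> x" "y \<otimes> z = z \<otimes> y" unfolding zm using G xy by (simp_all add: m_assoc) (metis G m_assoc)
qed

end

section \<open>Metric trees\<close>

text \<open>A tree is given by the distances between its vertices: the four-point condition says that it has no
  cycles, and the existence of medians that it contains its branch points.\<close>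

locale tree_metric =
  fixes T :: "'p set" and d :: "'p \<Rightarrow> 'p \<Rightarrow> int"
  assumes dist_eq_0: "\<lbrakk>x \<in> T; y \<in> T\<rbrakk> \<Longrightarrow> d x y = 0 \<longleftrightarrow> x = y"
    and dist_sym: "\<lbrakk>x \<in> T; y \<in> T\<rbrakk> \<Longrightarrow> d x y = d y x"
    and four_point: "\<lbrakk>x \<in> T; y \<in> T; z \<in> T; w \<in> T\<rbrakk>
      \<Longrightarrow> d x y + d z w \<le> max (d x z + d y w) (d x w + d y z)"
    and median_ex: "\<lbrakk>x \<in> T; y \<in> T; z \<in> T\<rbrakk>
      \<Longrightarrow> \<exists>m\<in>T. d x m + d m y = d x y \<and> d y m + d m z = d y z \<and> d x m + d m z = d x z"
begin

definition btw :: "'p \<Rightarrow> 'p \<Rightarrow> 'p \<Rightarrow> bool" where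
  "btw x y z \<longleftrightarrow> d x y + d y z = d x z"

lemma dist_self: "x \<in> T \<Longrightarrow> d x x = 0"
  using dist_eq_0 by simp

lemma dist_nonneg: "\<lbrakk>x \<in> T; y \<in> T\<rbrakk> \<Longrightarrow> 0 \<le> d x y"
  using four_point[of x x y y] dist_self[of x] dist_self[of y] by simp

lemma dist_pos: "\<lbrakk>x \<in> T; y \<in> T; x \<noteq> y\<rbrakk> \<Longrightarrow> 0 < d x y"
  using dist_nonneg[of x y] dist_eq_0[of x y] by linarith

lemma triangle: "\<lbrakk>x \<in> T; y \<in> T; z \<in> T\<rbrakk> \<Longrightarrow> d x z \<le> d x y + d y z"
  using four_point[of x z y y] dist_self[of y] dist_sym[of y z] by simp

lemma btw_sym: "\<lbrakk>x \<in> T; y \<in> T; z \<in> T; btw x y z\<rbrakk> \<Longrightarrow> btw z y x"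
  unfolding btw_def using dist_sym[of x y] dist_sym[of y z] dist_sym[of x z] by linarith

lemma obtain_median:
  assumes "x \<in> T" "y \<in> T" "z \<in> T"
  obtains m where "m \<in> T" "btw x m y" "btw y m z" "btw x m z"
  using median_ex[OF assms] unfolding btw_def by blast

text \<open>Two points of a segment that are given by their distances from one end are as far apart as these
  distances tell; in particular a point of a segment is determined by its distance from one end.\<close>

lemma btw_dist:
  assumes "x \<in> T" "y \<in> T" "z \<in> T" "w \<in> T" "btw x y w" "btw x z w" "d x y \<le> d x z"
  shows "d y z = d x z - d x y"
proof -
  have "d x w + d y z \<le> max (d x y + d w z) (d x z + d w y)"
    using four_point[of x w y z] assms by simp
  moreover have "d x z \<le> d x y + d y z" using triangle assms by blast
  ultimately show ?thesis
    using assms(5-7) dist_sym[of y w] dist_sym[of z w] assms(1-4) unfolding btw_def by linarith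
qed

lemma btw_unique:
  assumes "x \<in> T" "y \<in> T" "z \<in> T" "w \<in> T" "btw x y w" "btw x z w" "d x y = d x z"
  shows "y = z"
  using btw_dist[OF assms(1-6)] assms(7) dist_eq_0[of y z] assms(2,3) by simp

text \<open>Local geodesics are geodesic; this is where the tree has no cycles.\<close>

lemma btw_chain:
  assumes "x \<in> T" "y \<in> T" "z \<in> T" "w \<in> T" "btw x y z" "btw y z w" "y \<noteq> z"
  shows "btw x y w" "btw x z w"
proof -
  have "d x z + d y w \<le> max (d x y + d z w) (d x w + d z y)"
    using four_point[of x z y w] assms by simp
  moreover have "d x w \<le> d x z + d z w" using triangle assms by blast
  moreover have "0 < d y z" using dist_pos assms by blast
  ultimately show "btw x y w" "btw x z w"
    using assms(5,6) dist_sym[of y z] assms(2,3) unfolding btw_def by linarith+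
qed

end

section \<open>Square roots of commutators acting on trees\<close>

text \<open>The last assumption says that no group element interchanges two vertices.  The proofs
  below produce such interchanges.\<close>

locale tree_action = group_action G T \<phi> + tree_metric T d
  for G :: "('g, 'h) monoid_scheme" (structure) and T :: "'p set"
    and \<phi> :: "'g \<Rightarrow> 'p \<Rightarrow> 'p" and d :: "'p \<Rightarrow> 'p \<Rightarrow> int" +
  assumes isometry: "\<lbrakk>g \<in> carrier G; x \<in> T; y \<in> T\<rbrakk> \<Longrightarrow> d (\<phi> g x) (\<phi> g y) = d x y"
    and fixes_if_square_fixes: "\<lbrakk>g \<in> carrier G; x \<in> T; \<phi> g (\<phi> g x) = x\<rbrakk> \<Longrightarrow> \<phi> g x = x"
begin

sublocale group G
  using group_hom group_hom.axioms(1) by blast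

lemma act_closed [simp]: "\<lbrakk>g \<in> carrier G; x \<in> T\<rbrakk> \<Longrightarrow> \<phi> g x \<in> T"
  using element_image by blast

lemma act_inv [simp]:
  assumes "g \<in> carrier G" "x \<in> T"
  shows "\<phi> (inv g) (\<phi> g x) = x" "\<phi> g (\<phi> (inv g) x) = x"
  using orbit_sym_aux[OF assms refl] orbit_sym_aux[of "inv g" x] assms by simp_all

lemma act_eq_iff: "\<lbrakk>g \<in> carrier G; x \<in> T; y \<in> T\<rbrakk> \<Longrightarrow> \<phi> g x = \<phi> g y \<longleftrightarrow> x = y"
  using act_inv(1) by metis

lemma dist_act_inv:
  assumes "g \<in> carrier G" "x \<in> T" "y \<in> T"
  shows "d (\<phi> (inv g) x) y = d x (\<phi> g y)" "d x (\<phi> (inv g) y) = d (\<phi> g x) y"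
  using isometry[of g "\<phi> (inv g) x" y] isometry[of g x "\<phi> (inv g) y"] assms by simp_all

lemma btw_act_iff:
  "\<lbrakk>g \<in> carrier G; x \<in> T; y \<in> T; z \<in> T\<rbrakk> \<Longrightarrow> btw (\<phi> g x) (\<phi> g y) (\<phi> g z) \<longleftrightarrow> btw x y z"
  by (simp add: btw_def isometry)

text \<open>If \<open>t\<^sup>2\<close> shifts an axis through \<open>p\<close>, then \<open>p\<close> lies on an axis of \<open>t\<close> as well, because
  otherwise \<open>d (t p) (t\<^sup>3 p)\<close> would exceed \<open>d p (t\<^sup>2 p)\<close> by twice the distance from \<open>t p\<close> to the axis.\<close>

lemma square_root_on_axis:
  assumes t: "t \<in> carrier G" and T: "p \<in> T" "q \<in> T"
    and double: "btw p (\<phi> t (\<phi> t p)) (\<phi> t (\<phi> t (\<phi> t (\<phi> t p))))"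
    and mid: "btw p q (\<phi> t (\<phi> t p))" "2 * d p q = d p (\<phi> t (\<phi> t p))" and "p \<noteq> q"
  shows "\<phi> t p = q"
proof -
  let ?t = "\<phi> t" let ?N = "d p q" let ?m = "d p (?t p)"
  have N: "0 < ?N" using dist_pos assms by blast
  have D2: "d p (?t (?t p)) = 2 * ?N" using mid by simp
  have D4: "d p (?t (?t (?t (?t p)))) = 4 * ?N"
    using double t T D2 unfolding btw_def by (simp add: isometry)
  have D3: "d p (?t (?t (?t p))) = 2 * ?N + ?m"
  proof -
    have "d p (?t (?t (?t p))) \<le> 2 * ?N + ?m"
      using triangle[of p "?t (?t p)" "?t (?t (?t p))"] t T D2 by (simp add: isometry)
    moreover have "4 * ?N + ?m \<le> max (2 * ?N + ?m) (d p (?t (?t (?t p))) + 2 * ?N)"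
      using four_point[of p "?t (?t (?t (?t p)))" "?t (?t p)" "?t (?t (?t p))"] t T D2 D4
        dist_sym[of p "?t p"] dist_sym[of p "?t (?t p)"] by (simp add: isometry)
    ultimately show ?thesis using N by linarith
  qed
  have "2 * ?N + 2 * ?m \<le> max (2 * ?m) (4 * ?N)"
    using four_point[of p "?t (?t (?t p))" "?t p" "?t (?t p)"] t T D2 D3
      dist_sym[of p "?t p"] dist_sym[of p "?t (?t p)"] by (simp add: isometry)
  moreover have "2 * ?N \<le> ?m + ?m"
    using triangle[of p "?t p" "?t (?t p)"] t T D2 by (simp add: isometry)
  ultimately have "?m = ?N" using N by linarith
  then show ?thesis
    using btw_unique[of p "?t p" q "?t (?t p)"] t T mid(1) D2 unfolding btw_def
    by (simp add: isometry)
qed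

subsection \<open>Products of two elliptic elements\<close>

text \<open>The branch point of \<open>p\<close>, \<open>q\<close> and \<open>a q\<close> is fixed by \<open>a\<close>, because \<open>a\<close> carries \<open>[p, q]\<close> to \<open>[p, a q]\<close>
  and leaves distances from \<open>p\<close> unchanged.  So it is \<open>p\<close> if no fixed point is nearer to \<open>q\<close>.\<close>

lemma dist_from_fixed_point:
  assumes "a \<in> carrier G" "p \<in> T" "q \<in> T" "\<phi> a p = p"
    and nearest: "\<And>x. x \<in> T \<Longrightarrow> \<phi> a x = x \<Longrightarrow> d p q \<le> d x q"
  shows "btw q p (\<phi> a q)"
proof -
  obtain m where m: "m \<in> T" "btw p m q" "btw q m (\<phi> a q)" "btw p m (\<phi> a q)"
    using obtain_median[of p q "\<phi> a q"] assms by auto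
  have "btw p (\<phi> a m) (\<phi> a q)" using btw_act_iff[of a p m q] m assms by simp
  moreover have "d p (\<phi> a m) = d p m" using isometry[of a p m] m assms by simp
  ultimately have "\<phi> a m = m" using btw_unique[of p "\<phi> a m" m "\<phi> a q"] m assms by simp
  then have "d p q \<le> d m q" using nearest m by blast
  then have "d p m = 0" using m(2) dist_nonneg[of p m] assms m(1) unfolding btw_def by linarith
  then show ?thesis using m assms dist_eq_0[of p m] by auto
qed

text \<open>If the fixed point sets of \<open>a\<close> and \<open>b\<close> are disjoint, then \<open>ab\<close> has an axis through the
  bridge \<open>[p, q]\<close> between them, and \<open>t\<inverse>a\<close> interchanges \<open>p\<close> and \<open>q\<close>.\<close>

lemma square_of_two_elliptic:
  assumes G: "a \<in> carrier G" "b \<in> carrier G" "t \<in> carrier G" and eq: "t \<otimes> t = a \<otimes> b"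
    and "x \<in> T" "\<phi> a x = x" "y \<in> T" "\<phi> b y = y"
  shows "\<exists>z\<in>T. \<phi> t z = z"
proof -
  let ?S = "\<lambda>(p, q). p \<in> T \<and> \<phi> a p = p \<and> q \<in> T \<and> \<phi> b q = q"
  \<comment> \<open>The bridge between the two fixed point sets.\<close>
  obtain p q where S: "?S (p, q)"
    and least: "\<And>p' q'. ?S (p', q') \<Longrightarrow> nat (d p q) \<le> nat (d p' q')"
    using ex_has_least_nat[of ?S "(x, y)" "\<lambda>(p, q). nat (d p q)"] assms by auto
  have T: "p \<in> T" "q \<in> T" and fix_p: "\<phi> a p = p" and fix_q: "\<phi> b q = q" using S by auto
  have le: "d p q \<le> d p' q'" if "?S (p', q')" for p' q'
    using least[OF that] dist_nonneg[of p' q'] that by auto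
  have bridge_p: "btw q p (\<phi> a q)"
    using dist_from_fixed_point[OF G(1) T fix_p] le T fix_q by auto
  have bridge_q: "btw p q (\<phi> b p)"
  proof (rule dist_from_fixed_point[OF G(2) T(2,1) fix_q])
    fix z assume "z \<in> T" "\<phi> b z = z"
    then show "d q p \<le> d z p" using le[of p z] T fix_p dist_sym[of p q] dist_sym[of p z] by simp
  qed
  have tt: "\<phi> t (\<phi> t z) = \<phi> a (\<phi> b z)" if "z \<in> T" for z
    using that G composition_rule[of z t t] composition_rule[of z a b] by (simp add: eq)
  show ?thesis
  proof (cases "p = q")
    case True
    then have "\<phi> t (\<phi> t p) = p" using tt fix_p fix_q T by simp
    then show ?thesis using fixes_if_square_fixes G(3) T by blast
  next
    case False
    let ?f = "\<lambda>z. \<phi> t (\<phi> t z)"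
    have f: "?f z \<in> T" "btw (?f z) (?f z') (?f z'') \<longleftrightarrow> btw z z' z''"
      if "z \<in> T" "z' \<in> T" "z'' \<in> T" for z z' z''
      using that G btw_act_iff by simp_all
    have fq: "?f q = \<phi> a q" using tt fix_q T by simp
    have 1: "btw p (\<phi> a q) (?f p)"
      using bridge_q btw_act_iff[of a p q "\<phi> b p"] G T fix_p tt by simp
    have 2: "btw (\<phi> a q) (?f p) (?f (\<phi> a q))"
      using bridge_p f(2)[of q p "\<phi> a q"] G T fq by simp
    have 3: "btw (?f p) (?f (\<phi> a q)) (?f (?f p))"
      using 1 f(2)[of p "\<phi> a q" "?f p"] G T by simp
    have ne: "p \<noteq> \<phi> a q" using False act_eq_iff[of a p q] G T fix_p by simp
    have ne': "\<phi> a q \<noteq> ?f p" using fq False act_eq_iff[of t] G T by (metis act_closed)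
    have "btw p (?f p) (?f (\<phi> a q))"
      using btw_chain(2)[of p "\<phi> a q" "?f p" "?f (\<phi> a q)"] 1 2 ne' G T by simp
    then have 4: "btw p (?f p) (?f (?f p))"
      using btw_chain(1)[of p "?f p" "?f (\<phi> a q)" "?f (?f p)"] 3 ne act_eq_iff[of t] G T by simp
    have "d (\<phi> a q) (?f p) = d p (\<phi> a q)"
      using fq isometry[of t] isometry[of a p q] G T fix_p dist_sym[of p q] by (metis act_closed)
    then have tp: "\<phi> t p = \<phi> a q"
      using square_root_on_axis[of t p "\<phi> a q"] 1 4 ne G T unfolding btw_def by simp
    have tq: "\<phi> t q = p"
      using fq tp act_eq_iff[of t] G T by (metis act_closed)
    let ?g = "inv t \<otimes> a"
    have "\<phi> ?g q = p" "\<phi> ?g p = q"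
      using G T fix_p tp tq act_inv(1)[of t p] act_inv(1)[of t q] composition_rule[of _ "inv t" a]
      by (simp_all add: composition_rule)
    then have "p = q" using fixes_if_square_fixes[of ?g q] G T by simp
    with False show ?thesis ..
  qed
qed

text \<open>The commutator of an elliptic \<open>a\<close> with \<open>b\<close> is the product of \<open>a\<close> and the elliptic \<open>ba\<inverse>b\<inverse>\<close>.\<close>

lemma square_commutator_elliptic:
  assumes G: "a \<in> carrier G" "b \<in> carrier G" "t \<in> carrier G"
    and eq: "t \<otimes> t = a \<otimes> b \<otimes> inv a \<otimes> inv b" and x: "x \<in> T" "\<phi> a x = x"
  shows "\<exists>z\<in>T. \<phi> t z = z"
proof (rule square_of_two_elliptic[of a "b \<otimes> inv a \<otimes> inv b"])
  show "t \<otimes> t = a \<otimes> (b \<otimes> inv a \<otimes> inv b)" using eq G by (simp add: m_assoc)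
  have "\<phi> (inv a) x = x" using act_inv(1)[of a x] G x by simp
  then show "\<phi> (b \<otimes> inv a \<otimes> inv b) (\<phi> b x) = \<phi> b x"
    using G x by (simp add: composition_rule)
qed (use G x in auto)

subsection \<open>Two hyperbolic generators\<close>

text \<open>The point \<open>u\<close> is where the segments from \<open>p\<close> to \<open>a p\<close> and to \<open>b p\<close> part, and \<open>v\<close> is where those to
  \<open>a\<inverse>p\<close> and to \<open>b\<inverse>p\<close> part; by \<open>no_cancel\<close> there is no other cancellation in the commutator.  Hence
  an axis of \<open>[a, b]\<close> runs from \<open>u\<close> through \<open>a p\<close>, \<open>abv\<close>, \<open>aba\<inverse>p\<close> to \<open>[a, b] u\<close>, and \<open>abv\<close> is the middle of
  this path.  As \<open>t\<close> moves \<open>u\<close> to the middle, it carries the part of \<open>a [p, b p]\<close> in the first half to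
  the part of \<open>[a, b] [b p, p]\<close> in the second, which runs the other way.  So \<open>t\<inverse>a\<close> interchanges \<open>u\<close> and
  \<open>bv\<close>.\<close>

lemma interchanged_on_axis:
  assumes G: "a \<in> carrier G" "b \<in> carrier G" "t \<in> carrier G"
    and eq: "t \<otimes> t = a \<otimes> b \<otimes> inv a \<otimes> inv b"
    and T: "p \<in> T" "u \<in> T" "v \<in> T"
    and u: "btw p u (\<phi> a p)" "btw p u (\<phi> b p)" "btw (\<phi> a p) u (\<phi> b p)"
    and v: "btw p v (\<phi> (inv a) p)" "btw p v (\<phi> (inv b) p)" "btw (\<phi> (inv a) p) v (\<phi> (inv b) p)"
    and no_cancel: "btw (\<phi> (inv a) p) p (\<phi> b p)" "btw (\<phi> a p) p (\<phi> (inv b) p)"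
    and small: "d p u < d p (\<phi> a p)" "d p u < d p (\<phi> b p)"
      "d p v < d p (\<phi> a p)" "d p v < d p (\<phi> b p)"
      "d p u + d p v \<le> d p (\<phi> a p)" "d p u + d p v \<le> d p (\<phi> b p)"
  shows "\<phi> b v = u"
proof -
  let ?a = "\<phi> a" let ?b = "\<phi> b" let ?a' = "\<phi> (inv a)" let ?b' = "\<phi> (inv b)" let ?t = "\<phi> t"
  let ?A = "d p (?a p)" let ?B = "d p (?b p)" let ?k = "d p u" let ?l = "d p v"
  let ?f = "\<lambda>z. ?t (?t z)"
  let ?N = "(?A - ?k) + (?B - ?l)"
  define P1 where "P1 = ?a p"
  define P2 where "P2 = ?a (?b v)"
  define P3 where "P3 = ?a (?b (?a' p))"
  have P: "P1 \<in> T" "P2 \<in> T" "P3 \<in> T" unfolding P1_def P2_def P3_def using G T by auto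
  have f: "?f z = ?a (?b (?a' (?b' z)))" if "z \<in> T" for z
  proof -
    have "?f z = \<phi> (t \<otimes> t) z" using that G by (simp add: composition_rule)
    then show ?thesis using that G by (simp add: eq composition_rule)
  qed
  have fT: "?f z \<in> T" if "z \<in> T" for z using that G by simp
  have f_btw: "btw (?f x) (?f y) (?f z) \<longleftrightarrow> btw x y z" if "x \<in> T" "y \<in> T" "z \<in> T" for x y z
    using that G btw_act_iff by simp
  have f_dist: "d (?f x) (?f y) = d x y" if "x \<in> T" "y \<in> T" for x y
    using that G isometry by simp
  note symp = dist_sym[of p]
  have A': "d p (?a' p) = ?A" "d (?a' p) p = ?A" and B': "d p (?b' p) = ?B" "d (?b' p) p = ?B"
    using G T dist_act_inv(1)[of a p p] dist_act_inv(1)[of b p p] symp[of "?a' p"] symp[of "?b' p"]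
    by simp_all
  have ua: "d u (?a p) = ?A - ?k" and ub: "d u (?b p) = ?B - ?k"
    and va: "d v (?a' p) = ?A - ?l" and vb: "d v (?b' p) = ?B - ?l"
    using u(1,2) v(1,2) A' B' unfolding btw_def by linarith+
  have a'u: "d (?a' u) p = ?A - ?k" "d (?a' p) (?a' u) = ?k"
    using ua G T by (simp_all add: dist_act_inv)
  have b'u: "d p (?b' u) = ?B - ?k" "d (?b' p) (?b' u) = ?k"
    using ub G T dist_sym[of u "?b p"] by (simp_all add: dist_act_inv)
  have av: "d p (?a v) = ?A - ?l" "d (?a v) (?a p) = ?l"
    using va G T dist_act_inv(1)[of a p v] dist_sym[of v "?a' p"] symp[of v]
    by (simp_all add: isometry)
  have bv: "d p (?b v) = ?B - ?l" "d (?b v) (?b p) = ?l"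
    using vb G T dist_act_inv(1)[of b p v] dist_sym[of v "?b' p"] symp[of v]
    by (simp_all add: isometry)
  \<comment> \<open>The lengths of the four steps of the path.\<close>
  have d1: "d u P1 = ?A - ?k" using ua by (simp add: P1_def)
  have d2: "d P1 P2 = ?B - ?l" using bv G T by (simp add: P1_def P2_def isometry)
  have d3: "d P2 P3 = ?A - ?l" using va G T by (simp add: P2_def P3_def isometry)
  have d4: "d P3 (?f u) = ?B - ?k" using b'u G T by (simp add: P3_def f isometry)
  have fbp: "?f (?b p) = P3" using f[of "?b p"] G T by (simp add: P3_def)
  \<comment> \<open>The path does not turn back.\<close>
  have 1: "btw u P1 P2"
  proof -
    have "d (?a' p) (?b p) \<le> d (?a' p) (?a' u) + (d (?a' u) (?b v) + d (?b v) (?b p))"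
      using triangle[of "?a' p" "?a' u" "?b p"] triangle[of "?a' u" "?b v" "?b p"] G T by simp
    moreover have "d (?a' u) (?b v) \<le> d (?a' u) p + d p (?b v)" using triangle G T by simp
    ultimately have "d (?a' u) (?b v) = (?A - ?k) + (?B - ?l)"
      using no_cancel(1) A' a'u bv unfolding btw_def by linarith
    then show ?thesis unfolding btw_def using d1 d2 G T by (simp add: P2_def dist_act_inv)
  qed
  have 2: "btw P1 P2 P3"
    using btw_act_iff[of "a \<otimes> b" "?b' p" v "?a' p"] btw_sym[OF _ _ _ v(3)] G T
    by (simp add: composition_rule P1_def P2_def P3_def)
  have 3: "btw P2 P3 (?f u)"
  proof -
    have "d (?a p) (?b' p) \<le> d (?a p) (?a v) + (d (?a v) (?b' u) + d (?b' u) (?b' p))"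
      using triangle[of "?a p" "?a v" "?b' p"] triangle[of "?a v" "?b' u" "?b' p"] G T by simp
    moreover have "d (?a v) (?b' u) \<le> d (?a v) p + d p (?b' u)" using triangle G T by simp
    moreover have "d (?a p) (?a v) = ?l" "d (?b' u) (?b' p) = ?k" "d (?a v) p = ?A - ?l"
      "d (?a p) p = ?A"
      using av b'u dist_sym[of "?a v" "?a p"] dist_sym[of "?b' u" "?b' p"] symp[of "?a v"]
        symp[of "?a p"] G T by simp_all
    ultimately have "d (?a v) (?b' u) = (?A - ?l) + (?B - ?k)"
      using no_cancel(2) B' b'u unfolding btw_def by linarith
    moreover have "d P2 (?f u) = d (?a v) (?b' u)"
      using f[of u] G T dist_act_inv(2)[of a v "?b' u"] by (simp add: P2_def isometry)
    ultimately show ?thesis unfolding btw_def using d3 d4 by simp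
  qed
  have 4: "btw P3 (?f u) (?f P1)"
    using f_btw[of "?b p" u P1] btw_sym[OF _ _ _ u(3)] fbp G T by (simp add: P1_def)
  have 5: "btw (?f u) (?f P1) (?f P2)" using 1 f_btw T P by simp
  have ne: "P1 \<noteq> P2" "P2 \<noteq> P3" "P3 \<noteq> ?f u" "?f u \<noteq> ?f P1"
    using small d1 d2 d3 d4 f_dist[of u P1] dist_self T P fT[OF T(2)] by force+
  \<comment> \<open>Local geodesics are geodesic, so the path and its translate by \<open>t\<^sup>2\<close> form a segment.\<close>
  have c1: "btw u P2 P3" using btw_chain(2)[of u P1 P2 P3] 1 2 ne T P by blast
  have c2: "btw u P2 (?f u)" using btw_chain(1)[of u P2 P3 "?f u"] c1 3 ne T P fT by blast
  have c3: "btw P2 (?f u) (?f P1)" using btw_chain(2)[of P2 P3 "?f u" "?f P1"] 3 4 ne T P fT by blast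
  have c4: "btw P2 (?f u) (?f P2)"
    using btw_chain(1)[of P2 "?f u" "?f P1" "?f P2"] c3 5 ne T P fT by blast
  have dP2: "d u P2 = ?N" using 1 d1 d2 unfolding btw_def by simp
  have dP2f: "d P2 (?f u) = ?N" using 3 d3 d4 unfolding btw_def by simp
  have ne2: "P2 \<noteq> ?f u" "?f u \<noteq> ?f P2" "u \<noteq> P2"
    using dP2 dP2f small f_dist[of u P2] dist_self T P fT[OF T(2)] by force+
  have c5: "btw u (?f u) (?f P2)" using btw_chain(2)[of u P2 "?f u" "?f P2"] c2 c4 ne2 T P fT by blast
  have c6: "btw (?f u) (?f P2) (?f (?f u))" using c2 f_btw T P fT by blast
  have "btw u (?f u) (?f (?f u))"
    using btw_chain(1)[of u "?f u" "?f P2" "?f (?f u)"] c5 c6 ne2 T P fT by blast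
  moreover have "2 * d u P2 = d u (?f u)" using c2 dP2 dP2f unfolding btw_def by simp
  ultimately have tu: "?t u = P2"
    using square_root_on_axis[of t u P2] c2 ne2 G T P by simp
  \<comment> \<open>So \<open>t\<close> moves \<open>u\<close> along the axis by half the length of the closed path.  It remains to follow
    \<open>a u\<close>, which lies on the second step of the path and arrives on the fourth.\<close>
  have dubv: "d u (?b v) = ?B - ?k - ?l"
    using btw_dist[of p u "?b v" "?b p"] u(2) bv small(6) G T unfolding btw_def by simp
  have dauP2: "d (?a u) P2 = ?B - ?k - ?l" using dubv G T by (simp add: P2_def isometry)
  have duau: "d u (?a u) = ?A"
  proof -
    have "d u (?a u) \<le> ?A - ?k + ?k"
      using triangle[of u "?a p" "?a u"] d1 G T by (simp add: P1_def isometry)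
    moreover have "?N \<le> d u (?a u) + (?B - ?k - ?l)"
      using triangle[of u "?a u" P2] dP2 dauP2 G T P by simp
    ultimately show ?thesis by simp
  qed
  have Z: "?f (?b v) = ?a (?b (?a' v))" using f[of "?b v"] G T by simp
  have dZ: "d (?f (?b v)) (?f u) = ?B - ?k - ?l"
    using dubv f_dist dist_sym[of u "?b v"] G T by simp
  have dP2Z: "d P2 (?f (?b v)) = ?A"
  proof -
    have "d P3 (?f (?b v)) = ?l" unfolding Z P3_def using G T by (simp add: isometry)
    then have "d P2 (?f (?b v)) \<le> ?A"
      using triangle[of P2 P3 "?f (?b v)"] d3 G T P fT by simp
    moreover have "?N \<le> d P2 (?f (?b v)) + (?B - ?k - ?l)"
      using triangle[of P2 "?f (?b v)" "?f u"] dZ dP2f G T P fT by simp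
    ultimately show ?thesis by simp
  qed
  have "?t (?a u) = ?f (?b v)"
  proof (rule btw_unique[of P2 _ _ "?f u"])
    have 1: "d P2 (?t (?a u)) = ?A" using duau tu isometry[of t u "?a u"] G T by simp
    have 2: "d (?t (?a u)) (?f u) = ?B - ?k - ?l"
      using dauP2 tu isometry[of t "?a u" P2] G T P by simp
    show "btw P2 (?t (?a u)) (?f u)" "btw P2 (?f (?b v)) (?f u)"
      "d P2 (?t (?a u)) = d P2 (?f (?b v))"
      using 1 2 dZ dP2Z dP2f unfolding btw_def by simp_all
  qed (use G T P fT in simp_all)
  then have au: "?a u = ?t (?b v)" using act_eq_iff[of t] G T by simp
  let ?g = "inv t \<otimes> a"
  have "\<phi> ?g u = ?b v" using au G T by (simp add: composition_rule)
  moreover have "\<phi> ?g (?b v) = u"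
    using tu[symmetric] G T by (simp add: composition_rule P2_def)
  ultimately show ?thesis using fixes_if_square_fixes[of ?g u] G T by simp
qed

subsection \<open>Nielsen reduction\<close>

text \<open>The pairs of generators that would be counterexamples.  They are closed under the Nielsen moves,
  since these change the commutator only by conjugation and inversion, and \<open>t\<close> may be changed
  accordingly.\<close>

definition root_pair :: "'g \<Rightarrow> 'g \<Rightarrow> bool" where
  "root_pair a b \<longleftrightarrow> a \<in> carrier G \<and> b \<in> carrier G \<and>
    (\<exists>t\<in>carrier G. t \<otimes> t = a \<otimes> b \<otimes> inv a \<otimes> inv b \<and> (\<forall>x\<in>T. \<phi> t x \<noteq> x))"

lemma no_fixed_point_conj_inv:
  assumes "g \<in> carrier G" "t \<in> carrier G" "\<forall>x\<in>T. \<phi> t x \<noteq> x"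
  shows "\<forall>x\<in>T. \<phi> (g \<otimes> inv t \<otimes> inv g) x \<noteq> x"
proof
  fix x assume x: "x \<in> T"
  show "\<phi> (g \<otimes> inv t \<otimes> inv g) x \<noteq> x"
  proof
    assume "\<phi> (g \<otimes> inv t \<otimes> inv g) x = x"
    then have "\<phi> g (\<phi> (inv t) (\<phi> (inv g) x)) = x"
      using assms x by (simp add: composition_rule)
    then have "\<phi> (inv t) (\<phi> (inv g) x) = \<phi> (inv g) x"
      using act_inv(1)[of g "\<phi> (inv t) (\<phi> (inv g) x)"] assms x by simp
    then have "\<phi> t (\<phi> (inv g) x) = \<phi> (inv g) x"
      using act_inv(2)[of t "\<phi> (inv g) x"] assms x by simp
    with assms x show False by auto
  qed
qed

lemma root_pair_swap: "root_pair b a" if "root_pair a b"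
proof -
  from that obtain t where t: "a \<in> carrier G" "b \<in> carrier G" "t \<in> carrier G"
    "t \<otimes> t = a \<otimes> b \<otimes> inv a \<otimes> inv b" "\<forall>x\<in>T. \<phi> t x \<noteq> x" unfolding root_pair_def by blast
  have "inv t \<otimes> inv t = inv (t \<otimes> t)" using t(3) by (simp add: inv_mult_group)
  then have "inv t \<otimes> inv t = b \<otimes> a \<otimes> inv b \<otimes> inv a"
    unfolding t(4) using t(1,2) by (simp add: free_reduce)
  moreover have "\<forall>x\<in>T. \<phi> (inv t) x \<noteq> x"
    using no_fixed_point_conj_inv[of \<one> t] t by simp
  ultimately show ?thesis unfolding root_pair_def using t by blast
qed

lemma root_pair_inv: "root_pair (inv a) b" if "root_pair a b"
proof -
  from that obtain t where t: "a \<in> carrier G" "b \<in> carrier G" "t \<in> carrier G"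
    "t \<otimes> t = a \<otimes> b \<otimes> inv a \<otimes> inv b" "\<forall>x\<in>T. \<phi> t x \<noteq> x" unfolding root_pair_def by blast
  let ?s = "inv a \<otimes> inv t \<otimes> inv (inv a)"
  have "?s \<otimes> ?s = inv a \<otimes> inv (t \<otimes> t) \<otimes> a" using t(1-3) by (simp add: free_reduce)
  then have "?s \<otimes> ?s = inv a \<otimes> b \<otimes> inv (inv a) \<otimes> inv b"
    unfolding t(4) using t(1-3) by (simp add: free_reduce)
  moreover have "\<forall>x\<in>T. \<phi> ?s x \<noteq> x" using no_fixed_point_conj_inv[of "inv a" t] t by simp
  ultimately show ?thesis unfolding root_pair_def using t by blast
qed

lemma root_pair_mult: "root_pair (a \<otimes> b) b" if "root_pair a b"
proof -
  from that have "a \<in> carrier G" "b \<in> carrier G" unfolding root_pair_def by auto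
  then have "(a \<otimes> b) \<otimes> b \<otimes> inv (a \<otimes> b) \<otimes> inv b = a \<otimes> b \<otimes> inv a \<otimes> inv b"
    by (simp add: free_reduce)
  with that show ?thesis unfolding root_pair_def by auto
qed

lemma root_pair_hyperbolic:
  assumes "root_pair a b" "x \<in> T"
  shows "\<phi> a x \<noteq> x"
  using assms square_commutator_elliptic[of a b _ x] unfolding root_pair_def by metis

text \<open>The base point varies together with the pair, which replaces conjugating the pair.\<close>

definition shortest :: "'g \<Rightarrow> 'g \<Rightarrow> 'p \<Rightarrow> bool" where
  "shortest a b p \<longleftrightarrow> root_pair a b \<and> p \<in> T \<and> (\<forall>a' b' p'. root_pair a' b' \<longrightarrow> p' \<in> T \<longrightarrow>
    d p (\<phi> a p) + d p (\<phi> b p) \<le> d p' (\<phi> a' p') + d p' (\<phi> b' p'))"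

lemma shortest_swap: "shortest a b p \<Longrightarrow> shortest b a p"
  unfolding shortest_def using root_pair_swap by (metis add.commute)

lemma dist_inv: "\<lbrakk>a \<in> carrier G; p \<in> T\<rbrakk> \<Longrightarrow> d p (\<phi> (inv a) p) = d p (\<phi> a p)"
  using dist_act_inv(2)[of a p p] dist_sym[of p "\<phi> a p"] by simp

lemma shortest_inv: "shortest a b p \<Longrightarrow> shortest (inv a) b p"
  unfolding shortest_def using root_pair_inv dist_inv root_pair_def by metis

lemma shortest_inv2: "shortest a b p \<Longrightarrow> shortest a (inv b) p"
  using shortest_swap shortest_inv by blast

text \<open>The Nielsen move from \<open>a\<close> to \<open>ab\<close> does not shorten; so at most half of \<open>[p, b p]\<close> cancels against
  \<open>[p, a\<inverse>p]\<close>.\<close>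

lemma shortest_product:
  assumes "shortest a b p"
  shows "d p (\<phi> a p) \<le> d (\<phi> (inv a) p) (\<phi> b p)"
proof -
  have "a \<in> carrier G" "b \<in> carrier G" "p \<in> T"
    using assms unfolding shortest_def root_pair_def by auto
  moreover have "d p (\<phi> a p) \<le> d p (\<phi> (a \<otimes> b) p)"
    using assms root_pair_mult[of a b] unfolding shortest_def by fastforce
  ultimately show ?thesis by (simp add: composition_rule dist_act_inv)
qed

text \<open>Moving the base point along a common initial segment of \<open>[p, a p]\<close>, \<open>[p, a\<inverse> p]\<close> and
  \<open>[p, b p]\<close> shortens \<open>a\<close> and does not lengthen \<open>b\<close>.\<close>

lemma shortest_no_common_segment:
  assumes s: "shortest a b p" and q: "q \<in> T" "btw p q (\<phi> a p)" "btw p q (\<phi> (inv a) p)" "btw p q (\<phi> b p)"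
  shows "q = p"
proof (rule ccontr)
  assume "q \<noteq> p"
  have rp: "root_pair a b" and G: "a \<in> carrier G" "b \<in> carrier G" and p: "p \<in> T"
    using s unfolding shortest_def root_pair_def by auto
  let ?A = "d p (\<phi> a p)" and ?r = "d p q"
  have r: "0 < ?r" using dist_pos \<open>q \<noteq> p\<close> p q by blast
  have aq: "btw p (\<phi> a q) (\<phi> a p)"
    using btw_sym[of "\<phi> a p" "\<phi> a q" p] btw_act_iff[of a p q "\<phi> (inv a) p"] q G p by simp
  have daq: "d (\<phi> a q) (\<phi> a p) = ?r" using isometry[of a q p] dist_sym[of p q] G p q by simp
  have "d q (\<phi> b q) \<le> d q (\<phi> b p) + ?r"
    using triangle[of q "\<phi> b p" "\<phi> b q"] isometry[of b p q] G p q by simp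
  then have b: "d q (\<phi> b q) \<le> d p (\<phi> b p)" using q(4) unfolding btw_def by simp
  have "?r \<noteq> ?A"
  proof
    assume eq: "?r = ?A"
    then have qa: "q = \<phi> a p" using q p G dist_eq_0[of q "\<phi> a p"] unfolding btw_def by simp
    have "d p (\<phi> a q) = 0" using aq daq eq unfolding btw_def by simp
    then have "\<phi> a (\<phi> a p) = p" using qa dist_eq_0[of p "\<phi> a q"] p q G by simp
    then show False using fixes_if_square_fixes root_pair_hyperbolic[OF rp p] G p by blast
  qed
  moreover have "?r \<le> ?A" using q(2) dist_nonneg[of q "\<phi> a p"] q p G unfolding btw_def by simp
  moreover have "d q (\<phi> a q) = \<bar>?A - 2 * ?r\<bar>"
  proof (cases "?r \<le> d p (\<phi> a q)")
    case True
    then show ?thesis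
      using btw_dist[of p q "\<phi> a q" "\<phi> a p"] q(1,2) aq daq p G unfolding btw_def by simp
  next
    case False
    then show ?thesis
      using btw_dist[of p "\<phi> a q" q "\<phi> a p"] q(1,2) aq daq p G dist_sym[of q "\<phi> a q"]
      unfolding btw_def by simp
  qed
  ultimately have "d q (\<phi> a q) < ?A" using r by linarith
  then show False using s rp q(1) b unfolding shortest_def by fastforce
qed

text \<open>Of the segments from \<open>p\<close> to \<open>b p\<close> and to \<open>a\<inverse>p\<close>, at most one leaves \<open>p\<close> in the direction of \<open>a p\<close>: the
  shorter of the two common parts with \<open>[p, a p]\<close> would belong to all three segments.\<close>

lemma shortest_cancel_one_way:
  assumes s: "shortest a b p"
  shows "btw (\<phi> a p) p (\<phi> b p) \<or> btw (\<phi> a p) p (\<phi> (inv a) p)"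
proof (rule ccontr)
  assume *: "\<not> ?thesis"
  have G: "a \<in> carrier G" "b \<in> carrier G" and p: "p \<in> T"
    using s unfolding shortest_def root_pair_def by auto
  obtain u where u: "u \<in> T" "btw p u (\<phi> a p)" "btw (\<phi> a p) u (\<phi> b p)" "btw p u (\<phi> b p)"
    using obtain_median[of p "\<phi> a p" "\<phi> b p"] p G by auto
  obtain w where w: "w \<in> T" "btw p w (\<phi> a p)" "btw (\<phi> a p) w (\<phi> (inv a) p)" "btw p w (\<phi> (inv a) p)"
    using obtain_median[of p "\<phi> a p" "\<phi> (inv a) p"] p G by auto
  have T: "\<phi> a p \<in> T" "\<phi> (inv a) p \<in> T" "\<phi> b p \<in> T" using p G by auto
  have sub: "btw p x z" if "x \<in> T" "y \<in> T" "z \<in> T" "btw p x (\<phi> a p)" "btw p y (\<phi> a p)"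
    "d p x \<le> d p y" "btw p y z" for x y z
  proof -
    have "d x y = d p y - d p x" using btw_dist[of p x y "\<phi> a p"] that p T by blast
    then show ?thesis
      using triangle[of x y z] triangle[of p x z] that p unfolding btw_def by linarith
  qed
  show False
  proof (cases "d p u \<le> d p w")
    case True
    then have "u = p"
      using shortest_no_common_segment[OF s u(1,2) _ u(4)] sub[of u w "\<phi> (inv a) p"] u w T by blast
    with * u show False by simp
  next
    case False
    then have "w = p"
      using shortest_no_common_segment[OF s w(1,2,4)] sub[of w u "\<phi> b p"] u w T by simp
    with * w show False by simp
  qed
qed

text \<open>Two opposite directions at \<open>p\<close> cannot both be the direction of \<open>z\<close>.\<close>

lemma btw_or:
  assumes "p \<in> T" "x \<in> T" "y \<in> T" "z \<in> T" "btw x p y"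
  shows "btw x p z \<or> btw y p z"
proof -
  have "d x y + d p z \<le> max (d x p + d y z) (d x z + d y p)"
    using four_point[of x y p z] assms by simp
  then show ?thesis
    using triangle[of x p z] triangle[of y p z] dist_sym[of p y] assms unfolding btw_def by linarith
qed

text \<open>If nothing cancels in \<open>ab\<close> and in \<open>ba\<close>, then the interchange above, applied to \<open>(a, b)\<close> and to
  \<open>(b, a)\<close>, gives \<open>b v = u = a v\<close>.  So \<open>ab\<inverse>\<close> fixes \<open>u\<close>, and the elliptic case applies to the pair
  \<open>(ab\<inverse>, b\<inverse>)\<close>.\<close>

lemma shortest_not_without_cancellation:
  assumes s: "shortest a b p"
    and no_cancel: "btw (\<phi> (inv a) p) p (\<phi> b p)" "btw (\<phi> a p) p (\<phi> (inv b) p)"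
  shows False
proof -
  have rp: "root_pair a b" and G: "a \<in> carrier G" "b \<in> carrier G" and p: "p \<in> T"
    using s unfolding shortest_def root_pair_def by auto
  obtain t where t: "t \<in> carrier G" "t \<otimes> t = a \<otimes> b \<otimes> inv a \<otimes> inv b"
    using rp unfolding root_pair_def by blast
  let ?A = "d p (\<phi> a p)" and ?B = "d p (\<phi> b p)"
  have pos: "0 < ?A" "0 < ?B"
    using dist_pos root_pair_hyperbolic[OF rp p] root_pair_hyperbolic[OF root_pair_swap[OF rp] p] p G
    by (metis act_closed)+
  obtain u where u: "u \<in> T" "btw p u (\<phi> a p)" "btw (\<phi> a p) u (\<phi> b p)" "btw p u (\<phi> b p)"
    using obtain_median[of p "\<phi> a p" "\<phi> b p"] p G by auto
  obtain v where v: "v \<in> T" "btw p v (\<phi> (inv a) p)" "btw (\<phi> (inv a) p) v (\<phi> (inv b) p)"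
    "btw p v (\<phi> (inv b) p)"
    using obtain_median[of p "\<phi> (inv a) p" "\<phi> (inv b) p"] p G by auto
  have half: "2 * d p u \<le> ?A" "2 * d p u \<le> ?B" "2 * d p v \<le> ?A" "2 * d p v \<le> ?B"
  proof -
    have "?A \<le> d (\<phi> a p) (\<phi> b p)" "?B \<le> d (\<phi> b p) (\<phi> a p)"
      "?A \<le> d (\<phi> (inv a) p) (\<phi> (inv b) p)" "?B \<le> d (\<phi> (inv b) p) (\<phi> (inv a) p)"
      using shortest_product[OF shortest_inv[OF s]]
        shortest_product[OF shortest_inv[OF shortest_swap[OF s]]]
        shortest_product[OF shortest_inv2[OF s]]
        shortest_product[OF shortest_inv2[OF shortest_swap[OF s]]] dist_inv G p by simp_all
    moreover have "d (\<phi> b p) (\<phi> a p) = d (\<phi> a p) (\<phi> b p)"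
      "d (\<phi> (inv b) p) (\<phi> (inv a) p) = d (\<phi> (inv a) p) (\<phi> (inv b) p)"
      "d u (\<phi> a p) = d (\<phi> a p) u" "d v (\<phi> (inv a) p) = d (\<phi> (inv a) p) v"
      using dist_sym G p u v by simp_all
    ultimately show "2 * d p u \<le> ?A" "2 * d p u \<le> ?B" "2 * d p v \<le> ?A" "2 * d p v \<le> ?B"
      using u(2-4) v(2-4) dist_inv[of a p] dist_inv[of b p] G p unfolding btw_def by linarith+
  qed
  have "\<phi> b v = u"
    using interchanged_on_axis[of a b t p u v] G t p u v no_cancel half pos by simp
  moreover have "\<phi> a v = u"
  proof (rule interchanged_on_axis[of b a "inv t" p u v])
    have "inv t \<otimes> inv t = inv (t \<otimes> t)" using t(1) by (simp add: inv_mult_group)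
    then show "inv t \<otimes> inv t = b \<otimes> a \<otimes> inv b \<otimes> inv a"
      unfolding t(2) using G by (simp add: free_reduce)
    show "btw (\<phi> b p) u (\<phi> a p)" "btw (\<phi> (inv b) p) v (\<phi> (inv a) p)"
      "btw (\<phi> (inv b) p) p (\<phi> a p)" "btw (\<phi> b p) p (\<phi> (inv a) p)"
      using btw_sym[OF _ _ _ u(3)] btw_sym[OF _ _ _ v(3)] btw_sym[OF _ _ _ no_cancel(1)]
        btw_sym[OF _ _ _ no_cancel(2)] u(1) v(1) G p by simp_all
  qed (use G t p u v half pos in simp_all)
  ultimately have "\<phi> (inv b) u = v" "\<phi> a v = u" using act_inv(1)[of b v] G v by auto
  then have "\<phi> (a \<otimes> inv b) u = u" using G u by (simp add: composition_rule)
  moreover have "root_pair (a \<otimes> inv b) (inv b)"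
    using rp root_pair_swap root_pair_inv root_pair_mult by blast
  ultimately show False using root_pair_hyperbolic u by blast
qed

text \<open>Among the four directions from \<open>p\<close> to \<open>a p\<close>, \<open>a\<inverse>p\<close>, \<open>b p\<close> and \<open>b\<inverse>p\<close>, no three agree.  So either \<open>b\<close> or
  \<open>b\<inverse>\<close> is free of cancellation with \<open>a\<close> in the sense of the previous lemma.\<close>

lemma not_shortest: "\<not> shortest a b p"
proof
  assume s: "shortest a b p"
  have G: "a \<in> carrier G" "b \<in> carrier G" and p: "p \<in> T"
    using s unfolding shortest_def root_pair_def by auto
  note s' = shortest_swap[OF s]
  have one_way: "btw (\<phi> x p) p (\<phi> y p) \<or> btw (\<phi> x p) p (\<phi> (inv x) p)" if "shortest x y p" for x y
    using shortest_cancel_one_way that by blast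
  have T: "\<phi> a p \<in> T" "\<phi> b p \<in> T" "\<phi> (inv a) p \<in> T" "\<phi> (inv b) p \<in> T" using G p by auto
  note or = btw_or[OF p]
  have sym: "btw x p y \<longleftrightarrow> btw y p x" if "x \<in> T" "y \<in> T" for x y using btw_sym p that by blast
  have ow: "btw (\<phi> a p) p (\<phi> b p) \<or> btw (\<phi> a p) p (\<phi> (inv a) p)"
    "btw (\<phi> a p) p (\<phi> (inv b) p) \<or> btw (\<phi> a p) p (\<phi> (inv a) p)"
    "btw (\<phi> (inv a) p) p (\<phi> b p) \<or> btw (\<phi> (inv a) p) p (\<phi> a p)"
    "btw (\<phi> (inv a) p) p (\<phi> (inv b) p) \<or> btw (\<phi> (inv a) p) p (\<phi> a p)"
    "btw (\<phi> b p) p (\<phi> a p) \<or> btw (\<phi> b p) p (\<phi> (inv b) p)"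
    "btw (\<phi> b p) p (\<phi> (inv a) p) \<or> btw (\<phi> b p) p (\<phi> (inv b) p)"
    "btw (\<phi> (inv b) p) p (\<phi> a p) \<or> btw (\<phi> (inv b) p) p (\<phi> b p)"
    "btw (\<phi> (inv b) p) p (\<phi> (inv a) p) \<or> btw (\<phi> (inv b) p) p (\<phi> b p)"
    using one_way[OF s] one_way[OF shortest_inv2[OF s]] one_way[OF shortest_inv[OF s]]
      one_way[OF shortest_inv2[OF shortest_inv[OF s]]]
      one_way[OF s'] one_way[OF shortest_inv2[OF s']] one_way[OF shortest_inv[OF s']]
      one_way[OF shortest_inv2[OF shortest_inv[OF s']]] G by simp_all
  have "(btw (\<phi> (inv a) p) p (\<phi> b p) \<and> btw (\<phi> a p) p (\<phi> (inv b) p)) \<or>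
    (btw (\<phi> (inv a) p) p (\<phi> (inv b) p) \<and> btw (\<phi> a p) p (\<phi> b p))"
    using ow or T sym by metis
  then show False
    using shortest_not_without_cancellation[OF s] shortest_not_without_cancellation[OF shortest_inv2[OF s]] G by auto
qed

theorem square_commutator_fixes_point:
  assumes G: "a \<in> carrier G" "b \<in> carrier G" "t \<in> carrier G"
    and eq: "t \<otimes> t = a \<otimes> b \<otimes> inv a \<otimes> inv b" and "T \<noteq> {}"
  shows "\<exists>x\<in>T. \<phi> t x = x"
proof (rule ccontr)
  assume "\<not> ?thesis"
  then have rp: "root_pair a b" unfolding root_pair_def using assms by blast
  obtain p where p: "p \<in> T" using \<open>T \<noteq> {}\<close> by blast
  let ?S = "\<lambda>(a, b, p). root_pair a b \<and> p \<in> T"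
  let ?m = "\<lambda>(a, b, p). nat (d p (\<phi> a p) + d p (\<phi> b p))"
  have "?S (a, b, p)" using rp p by simp
  from ex_has_least_nat[of ?S, OF this, of ?m] obtain a b p
    where S: "root_pair a b" "p \<in> T"
      and least: "\<And>a' b' p'. root_pair a' b' \<Longrightarrow> p' \<in> T \<Longrightarrow> ?m (a, b, p) \<le> ?m (a', b', p')"
    by auto
  have "shortest a b p"
    unfolding shortest_def
  proof (intro conjI allI impI)
    fix a' b' p' assume *: "root_pair a' b'" "p' \<in> T"
    have "0 \<le> d p' (\<phi> a' p')" "0 \<le> d p' (\<phi> b' p')"
      using dist_nonneg * unfolding root_pair_def by simp_all
    with least[OF *] show "d p (\<phi> a p) + d p (\<phi> b p) \<le> d p' (\<phi> a' p') + d p' (\<phi> b' p')"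
      by simp
  qed (use S in auto)
  then show False using not_shortest by blast
qed

end

section \<open>The Cayley tree of a free group\<close>

text \<open>The vertices are the reduced words; left multiplication by a letter is the map \<open>push\<close>.\<close>

abbreviation flip :: "'x \<times> bool \<Rightarrow> 'x \<times> bool" where
  "flip \<equiv> apsnd Not"

lemma flip_flip [simp]: "flip (flip x) = x"
  by (cases x) simp

lemma flip_neq [simp]: "flip x \<noteq> x" "x \<noteq> flip x"
  by (cases x; simp)+

definition reduced :: "'x word \<Rightarrow> bool" where
  "reduced = successively (\<lambda>x y. y \<noteq> flip x)"

definition reduced_words :: "'x set \<Rightarrow> 'x word set" where
  "reduced_words X = {w \<in> words X. reduced w}"

definition push :: "'x \<times> bool \<Rightarrow> 'x word \<Rightarrow> 'x word" where
  "push x w = (if w \<noteq> [] \<and> hd w = flip x then tl w else x # w)"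

definition inverse_word :: "'x word \<Rightarrow> 'x word" where
  "inverse_word w = rev (map flip w)"

definition overlap :: "'a list \<Rightarrow> 'a list \<Rightarrow> nat" where
  "overlap u w = length (longest_common_prefix u w)"

definition word_dist :: "'a list \<Rightarrow> 'a list \<Rightarrow> int" where
  "word_dist u w = int (length u) + int (length w) - 2 * int (overlap u w)"

lemma overlap_simps [simp]:
  "overlap [] w = 0" "overlap w [] = 0" "overlap (x # u) (y # w) = (if x = y then Suc (overlap u w) else 0)"
  unfolding overlap_def by (cases w; simp)+

lemma overlap_self [simp]: "overlap u u = length u"
  by (induction u) simp_all

lemma lcp_sym: "longest_common_prefix u w = longest_common_prefix w u"
  by (induction u w rule: longest_common_prefix.induct) auto

lemma overlap_sym: "overlap u w = overlap w u"
  unfolding overlap_def by (simp only: lcp_sym)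

lemma overlap_le: "overlap u w \<le> length u" "overlap u w \<le> length w"
  unfolding overlap_def
  using longest_common_prefix_prefix1 longest_common_prefix_prefix2 prefix_length_le by blast+

lemma overlap_ultrametric: "min (overlap u v) (overlap v w) \<le> overlap u w"
proof (induction u v arbitrary: w rule: longest_common_prefix.induct)
  case (1 x xs y ys)
  then show ?case
  proof (cases w)
    case (Cons z zs)
    then show ?thesis using 1[of zs] by (cases "x = y"; cases "y = z") auto
  qed simp
qed simp_all

lemma overlap_map: "inj_on f (set u \<union> set w) \<Longrightarrow> overlap (map f u) (map f w) = overlap u w"
  by (induction u w rule: longest_common_prefix.induct) (auto simp: inj_on_def)

lemma overlap_prefix: "overlap (longest_common_prefix u w) u = overlap u w"
  by (induction u w rule: longest_common_prefix.induct) auto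

lemma reduced_Nil [simp]: "reduced []"
  by (simp add: reduced_def)

lemma reduced_Cons: "reduced (x # w) \<longleftrightarrow> (w = [] \<or> hd w \<noteq> flip x) \<and> reduced w"
  by (cases w) (auto simp: reduced_def)

lemma reduced_append_left: "reduced (u @ w) \<Longrightarrow> reduced u"
  by (induction u) (auto simp: reduced_Cons hd_append split: if_splits)

lemma Nil_in_reduced_words [simp]: "[] \<in> reduced_words X"
  by (simp add: reduced_words_def)

lemma Cons_in_reduced_words:
  "x # w \<in> reduced_words X \<longleftrightarrow> x \<in> X \<times> UNIV \<and> w \<in> reduced_words X \<and> (w = [] \<or> hd w \<noteq> flip x)"
  by (auto simp: reduced_words_def reduced_Cons)

lemma push_in_reduced_words:
  assumes "x \<in> X \<times> UNIV" "w \<in> reduced_words X"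
  shows "push x w \<in> reduced_words X"
  using assms by (cases w) (auto simp: push_def Cons_in_reduced_words)

lemma push_flip [simp]:
  assumes "w \<in> reduced_words X"
  shows "push (flip x) (push x w) = w" "push x (push (flip x) w) = w"
  using assms by (cases w; auto simp: push_def Cons_in_reduced_words)+

lemma push_Cons: "x # w \<in> reduced_words X \<Longrightarrow> push x w = x # w"
  by (auto simp: push_def Cons_in_reduced_words)

lemma map_push:
  assumes "inj_on f (insert (flip x) (set w))" "f (flip x) = flip (f x)"
  shows "map f (push x w) = push (f x) (map f w)"
proof (cases w)
  case (Cons y ys)
  then have "f y = flip (f x) \<longleftrightarrow> y = flip x"
    using inj_on_eq_iff[OF assms(1), of y "flip x"] unfolding assms(2) by simp
  with Cons show ?thesis by (simp add: push_def)
qed (simp add: push_def)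

lemma word_dist_sym: "word_dist u w = word_dist w u"
  by (simp add: word_dist_def overlap_sym)

lemma overlap_push_Cons:
  assumes "u \<in> reduced_words X" "u = flip x # u'"
  shows "overlap u' (x # w) = 0"
  using assms by (cases u') (simp_all add: Cons_in_reduced_words)

text \<open>If just one of the words begins with the inverse of \<open>x\<close>, its length drops and that of the other
  grows by one, while neither before nor after do they have a letter in common at the beginning.\<close>

lemma word_dist_push:
  assumes "u \<in> reduced_words X" "w \<in> reduced_words X"
  shows "word_dist (push x u) (push x w) = word_dist u w"
proof -
  have cancel: "word_dist (push x u) (push x w) = word_dist u w"
    if u: "u \<in> reduced_words X" "u = flip x # u'" and w: "w = [] \<or> hd w \<noteq> flip x" for u u' w
  proof -
    have "overlap u w = 0" using u(2) w by (cases w) auto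
    moreover have "push x u = u'" "push x w = x # w" using u(2) w by (auto simp: push_def)
    ultimately show ?thesis using u(2) overlap_push_Cons[OF u, of w] by (simp add: word_dist_def)
  qed
  consider (both) u' w' where "u = flip x # u'" "w = flip x # w'"
    | (left) u' where "u = flip x # u'" "w = [] \<or> hd w \<noteq> flip x"
    | (right) w' where "w = flip x # w'" "u = [] \<or> hd u \<noteq> flip x"
    | (none) "u = [] \<or> hd u \<noteq> flip x" "w = [] \<or> hd w \<noteq> flip x"
    by (metis list.collapse)
  then show ?thesis
  proof cases
    case both
    then show ?thesis by (simp add: push_def word_dist_def)
  next
    case left
    then show ?thesis using cancel assms by blast
  next
    case right
    then show ?thesis using cancel[of w w' u] assms word_dist_sym by metis
  next
    case none
    then have "push x u = x # u" "push x w = x # w" by (auto simp: push_def)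
    then show ?thesis by (simp add: word_dist_def)
  qed
qed

text \<open>The median of three vertices of a rooted tree is the deepest of the three pairwise branch points.\<close>

lemma word_dist_median:
  assumes "overlap x z \<le> overlap x y" "overlap y z \<le> overlap x y"
  defines "m \<equiv> longest_common_prefix x y"
  shows "word_dist x m + word_dist m y = word_dist x y"
    and "word_dist y m + word_dist m z = word_dist y z"
    and "word_dist x m + word_dist m z = word_dist x z"
proof -
  have m: "overlap m x = overlap x y" "overlap m y = overlap x y" "length m = overlap x y"
    using overlap_prefix[of x y] overlap_prefix[of y x] overlap_sym[of x y]
    by (simp_all add: m_def overlap_def lcp_sym[of x y])
  have "overlap m z = overlap x z" "overlap m z = overlap y z"
    using overlap_ultrametric[of m x z] overlap_ultrametric[of x m z] overlap_ultrametric[of m y z]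
      overlap_ultrametric[of y m z] overlap_le(1)[of m z] m assms(1,2) overlap_sym[of x m]
      overlap_sym[of y m] by linarith+
  then show "word_dist x m + word_dist m y = word_dist x y"
    and "word_dist y m + word_dist m z = word_dist y z"
    and "word_dist x m + word_dist m z = word_dist x z"
    using m overlap_sym[of x m] overlap_sym[of y m] by (simp_all add: word_dist_def)
qed

lemma word_dist_eq_0: "word_dist u w = 0 \<longleftrightarrow> u = w"
proof
  assume "word_dist u w = 0"
  then have "length (longest_common_prefix u w) = length u" "length (longest_common_prefix u w) = length w"
    using overlap_le[of u w] unfolding word_dist_def overlap_def by linarith+
  then have "longest_common_prefix u w = u" "longest_common_prefix u w = w"
    using longest_common_prefix_prefix1[of u w] longest_common_prefix_prefix2[of u w]
      not_equal_is_parallel[of "longest_common_prefix u w"] unfolding parallel_def by blast+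
  then show "u = w" by simp
qed (simp add: word_dist_def)

text \<open>The largest of the four overlaps between a word of the first pair and one of the second decides
  which of the two sums on the right bounds the left-hand side.\<close>

lemma word_dist_four_point:
  "word_dist x y + word_dist z w \<le> max (word_dist x z + word_dist y w) (word_dist x w + word_dist y z)"
proof -
  have ultra: "min (overlap x z) (overlap y z) \<le> overlap x y" "min (overlap x w) (overlap y w) \<le> overlap x y"
    "min (overlap x z) (overlap x w) \<le> overlap z w" "min (overlap y z) (overlap y w) \<le> overlap z w"
    using overlap_ultrametric[of x z y] overlap_ultrametric[of x w y] overlap_ultrametric[of z x w]
      overlap_ultrametric[of z y w] overlap_sym[of z x] overlap_sym[of z y] overlap_sym[of w y]
    by simp_all
  have "min (a + d) (b + c) \<le> e + f"
    if "min a c \<le> e" "min b d \<le> e" "min a b \<le> f" "min c d \<le> f" for a b c d e f :: nat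
    using that by linarith
  from this[OF ultra]
  have "min (overlap x z + overlap y w) (overlap x w + overlap y z) \<le> overlap x y + overlap z w" .
  then show ?thesis unfolding word_dist_def by linarith
qed

lemma tree_metric_reduced_words: "tree_metric (reduced_words X) word_dist"
proof (unfold_locales; (intro word_dist_four_point word_dist_eq_0 word_dist_sym)?)
  fix x y z :: "'a word"
  assume X: "x \<in> reduced_words X" "y \<in> reduced_words X" "z \<in> reduced_words X"
  have closed: "longest_common_prefix u w \<in> reduced_words X" if "u \<in> reduced_words X" for u w
  proof -
    obtain v where "u = longest_common_prefix u w @ v"
      using longest_common_prefix_prefix1[of u w] by (auto simp: prefix_def)
    then show ?thesis using that reduced_append_left unfolding reduced_words_def
      by (metis (no_types, lifting) append_in_lists_conv mem_Collect_eq)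
  qed
  show "\<exists>m\<in>reduced_words X. word_dist x m + word_dist m y = word_dist x y \<and>
    word_dist y m + word_dist m z = word_dist y z \<and> word_dist x m + word_dist m z = word_dist x z"
  proof -
    consider "overlap x z \<le> overlap x y" "overlap y z \<le> overlap x y"
      | "overlap x y \<le> overlap x z" "overlap z y \<le> overlap x z"
      | "overlap y x \<le> overlap y z" "overlap z x \<le> overlap y z"
      using overlap_sym[of x y] overlap_sym[of y z] overlap_sym[of x z] by linarith
    then show ?thesis
    proof cases
      case 1
      from word_dist_median[OF this] closed[OF X(1), of y] show ?thesis by blast
    next
      case 2
      from word_dist_median[OF this] closed[OF X(1), of z] show ?thesis
        by (metis add.commute word_dist_sym)
    next
      case 3
      from word_dist_median[OF this] closed[OF X(2), of z] show ?thesis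
        by (metis add.commute word_dist_sym)
    qed
  qed
qed

text \<open>A free group has no element of order two: in a word that equals its formal inverse, the two middle
  letters cancel if the length is even, and the middle letter is its own inverse if it is odd.\<close>

lemma reduced_inverse_word_eqD:
  assumes "reduced w" "inverse_word w = w"
  shows "w = []"
proof (rule ccontr)
  assume "w \<noteq> []"
  let ?n = "length w"
  have nth: "w ! i = flip (w ! (?n - 1 - i))" if "i < ?n" for i
  proof -
    have "w ! i = rev (map flip w) ! i" using assms(2) by (simp add: inverse_word_def)
    then show ?thesis using that by (simp add: rev_nth)
  qed
  show False
  proof (cases "even ?n")
    case True
    define k where "k = ?n div 2 - 1"
    have k: "?n = Suc (Suc (2 * k))" using True \<open>w \<noteq> []\<close> unfolding k_def by (cases ?n) auto
    have "w ! Suc k = flip (w ! k)" using nth[of "Suc k"] k by simp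
    moreover have "w ! Suc k \<noteq> flip (w ! k)"
      using assms(1) k successively_conv_nth[of _ w] by (simp add: reduced_def)
    ultimately show False by contradiction
  next
    case False
    then have "?n - 1 - ?n div 2 = ?n div 2" "?n div 2 < ?n" by presburger+
    then show False using nth[of "?n div 2"] flip_neq by metis
  qed
qed

lemma inverse_word_in_reduced_words:
  assumes "w \<in> reduced_words X"
  shows "inverse_word w \<in> reduced_words X"
proof -
  have "reduced (inverse_word w) \<longleftrightarrow> reduced w"
    unfolding reduced_def inverse_word_def
    by (simp add: successively_map) (rule successively_cong, auto)
  moreover have "inverse_word w \<in> words X"
    unfolding inverse_word_def
    by (rule inverse_in_words) (use assms in \<open>simp add: reduced_words_def\<close>)
  ultimately show ?thesis using assms by (simp add: reduced_words_def)
qed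

lemma inverse_word_inverse_word [simp]: "inverse_word (inverse_word w) = w"
  by (simp add: inverse_word_def rev_map o_def)

section \<open>HNN extensions over retracts\<close>

text \<open>Adding a vertex \<open>v\<close> to the graph turns the group \<open>B\<close> into the HNN extension \<open>A = \<langle>B, v | v commutes with e B\<rangle>\<close>,
  where \<open>e\<close> is the retraction of \<open>B\<close> onto the subgroup generated by the neighbours of \<open>v\<close>.  The kernel of
  \<open>A \<rightarrow> B\<close>, \<open>v \<mapsto> 1\<close>, is free on the conjugates \<open>nvn\<inverse>\<close> with \<open>n\<close> in the kernel of \<open>e\<close>, and its Cayley tree is the
  Bass--Serre tree of the extension.\<close>

locale retraction = group B + e: group_hom B B e for B :: "('b, 'c) monoid_scheme" (structure) and e +
  assumes idempotent: "b \<in> carrier B \<Longrightarrow> e (e b) = e b"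
begin

text \<open>The element \<open>n\<close> stands for the letter \<open>nvn\<inverse>\<close>.  The cosets of \<open>e B\<close>, which index these conjugates, are
  represented by the kernel of \<open>e\<close>.\<close>

definition letters :: "'b set" where
  "letters = {n \<in> carrier B. e n = \<one>}"

text \<open>As \<open>e b\<close> commutes with \<open>v\<close>, the conjugate of \<open>nvn\<inverse>\<close> by \<open>b\<close> is the letter given by \<open>bn(e b)\<inverse>\<close>.\<close>

definition shift :: "'b \<Rightarrow> 'b \<Rightarrow> 'b" where
  "shift b n = b \<otimes> n \<otimes> inv (e b)"

definition shift_word :: "'b \<Rightarrow> 'b word \<Rightarrow> 'b word" where
  "shift_word b = map (apfst (shift b))"

abbreviation "vertices \<equiv> reduced_words letters"

lemma letters_closed: "n \<in> letters \<Longrightarrow> n \<in> carrier B"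
  by (simp add: letters_def)

lemma one_in_letters: "\<one> \<in> letters"
  by (simp add: letters_def)

lemma shift_in_letters: "\<lbrakk>b \<in> carrier B; n \<in> letters\<rbrakk> \<Longrightarrow> shift b n \<in> letters"
  by (simp add: letters_def shift_def idempotent)

lemma shift_one: "n \<in> letters \<Longrightarrow> shift n \<one> = n"
  by (simp add: letters_def shift_def)

lemma shift_shift:
  "\<lbrakk>b \<in> carrier B; c \<in> carrier B; n \<in> letters\<rbrakk> \<Longrightarrow> shift b (shift c n) = shift (b \<otimes> c) n"
  by (simp add: letters_def shift_def free_reduce)

lemma one_shift: "n \<in> letters \<Longrightarrow> shift \<one> n = n"
  by (simp add: letters_def shift_def)

lemma inj_on_shift: "b \<in> carrier B \<Longrightarrow> inj_on (shift b) letters"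
  by (rule inj_on_inverseI[of _ "shift (inv b)"]) (simp add: shift_shift one_shift)

text \<open>That \<open>b\<^sup>2\<close> fixes the letter \<open>n\<close> means that \<open>n\<inverse>bn\<close> and \<open>e b\<close> have the same square.\<close>

lemma shift_fixes_if_square_fixes:
  assumes "no_square_commutator B" and b: "b \<in> carrier B" and n: "n \<in> letters"
    and eq: "shift b (shift b n) = n"
  shows "shift b n = n"
proof -
  have n': "n \<in> carrier B" using n by (rule letters_closed)
  let ?h = "inv n \<otimes> b \<otimes> n"
  have "b \<otimes> b \<otimes> n \<otimes> inv (e b) \<otimes> inv (e b) = n"
    using eq b n' by (simp add: shift_def free_reduce)
  then have "inv n \<otimes> (b \<otimes> b \<otimes> n \<otimes> inv (e b) \<otimes> inv (e b)) \<otimes> e b \<otimes> e b = inv n \<otimes> n \<otimes> e b \<otimes> e b"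
    using n' by simp
  then have "?h \<otimes> ?h = e b \<otimes> e b" using b n' by (simp add: free_reduce)
  then have "?h = e b" by (rule square_root_unique[OF assms(1), rotated 2]) (use b n' in simp_all)
  then have "n \<otimes> ?h \<otimes> inv (e b) = n \<otimes> e b \<otimes> inv (e b)" by simp
  then show ?thesis using b n' by (simp add: shift_def free_reduce)
qed

lemma letter_cases:
  assumes "w \<in> vertices" "x \<in> set w"
  obtains n c where "x = (n, c)" "n \<in> letters"
  using assms by (cases x) (auto simp: reduced_words_def)

lemma inj_on_shift_letter: "b \<in> carrier B \<Longrightarrow> inj_on (apfst (shift b)) (letters \<times> (UNIV :: bool set))"
  using inj_on_shift unfolding inj_on_def by auto

lemma flip_apfst [simp]: "apfst f (flip x) = flip (apfst f x)"
  by (cases x) simp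

lemma set_vertices: "w \<in> vertices \<Longrightarrow> set w \<subseteq> letters \<times> UNIV"
  by (auto simp: reduced_words_def)

lemma shift_word_in_vertices:
  assumes b: "b \<in> carrier B" and "w \<in> vertices"
  shows "shift_word b w \<in> vertices"
  using assms(2)
proof (induction w)
  case (Cons x w)
  obtain n c where x: "x = (n, c)" by (cases x)
  have "w = [] \<or> hd (shift_word b w) \<noteq> flip (apfst (shift b) x)"
  proof (cases w)
    case (Cons y w')
    have "y \<noteq> flip x" "y \<in> letters \<times> UNIV" "flip x \<in> letters \<times> UNIV"
      using Cons.prems Cons x by (auto simp: Cons_in_reduced_words)
    then have "apfst (shift b) y \<noteq> apfst (shift b) (flip x)"
      using inj_onD[OF inj_on_shift_letter[OF b], of y "flip x"] by metis
    then show ?thesis using Cons by (simp add: shift_word_def)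
  qed simp
  then show ?case
    using Cons shift_in_letters[OF b] x by (auto simp: Cons_in_reduced_words shift_word_def)
qed (simp add: shift_word_def)

lemma shift_word_mult:
  assumes "b \<in> carrier B" "c \<in> carrier B" "w \<in> vertices"
  shows "shift_word b (shift_word c w) = shift_word (b \<otimes> c) w"
  unfolding shift_word_def map_map
proof (rule map_cong[OF refl])
  fix x assume "x \<in> set w"
  with assms(3) obtain n d where "x = (n, d)" "n \<in> letters" by (rule letter_cases)
  then show "(apfst (shift b) \<circ> apfst (shift c)) x = apfst (shift (b \<otimes> c)) x"
    using shift_shift assms by simp
qed

lemma one_shift_word: "w \<in> vertices \<Longrightarrow> shift_word \<one> w = w"
  unfolding shift_word_def by (rule map_idI) (auto elim!: letter_cases simp: one_shift)

lemma shift_word_push: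
  assumes "b \<in> carrier B" "w \<in> vertices" "x \<in> letters \<times> UNIV"
  shows "shift_word b (push x w) = push (apfst (shift b) x) (shift_word b w)"
  unfolding shift_word_def
proof (rule map_push)
  have "insert (flip x) (set w) \<subseteq> letters \<times> UNIV" using set_vertices[OF assms(2)] assms(3) by auto
  then show "inj_on (apfst (shift b)) (insert (flip x) (set w))"
    using inj_on_shift_letter[OF assms(1)] inj_on_subset by blast
qed simp

lemma word_dist_shift_word:
  assumes "b \<in> carrier B" "u \<in> vertices" "w \<in> vertices"
  shows "word_dist (shift_word b u) (shift_word b w) = word_dist u w"
proof -
  have "inj_on (apfst (shift b)) (set u \<union> set w)"
    using inj_on_shift_letter[OF assms(1)] set_vertices[OF assms(2)] set_vertices[OF assms(3)]
      inj_on_subset by (metis Un_least)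
  then show ?thesis by (simp add: word_dist_def shift_word_def overlap_map)
qed

text \<open>Inverting \<open>y\<close> twice shows that \<open>b\<^sup>2\<close> fixes all letters of \<open>y\<close>.  Then so does \<open>b\<close>, and \<open>y\<close> is its own
  inverse.\<close>

lemma shift_word_inverse_eqD:
  assumes "no_square_commutator B" and b: "b \<in> carrier B" and y: "y \<in> vertices"
    and eq: "shift_word b y = inverse_word y"
  shows "y = []"
proof -
  have "shift_word b (inverse_word y) = inverse_word (shift_word b y)"
    by (simp add: shift_word_def inverse_word_def rev_map)
  then have square: "shift_word b (shift_word b y) = y"
    unfolding eq by simp
  have "shift_word b y = y"
    unfolding shift_word_def
  proof (rule map_idI)
    fix x assume x_in: "x \<in> set y"
    obtain n c where x: "x = (n, c)" "n \<in> letters" using letter_cases[OF y x_in] .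
    have "map (\<lambda>z. apfst (shift b) (apfst (shift b) z)) y = map (\<lambda>z. z) y"
      using square by (simp add: shift_word_def o_def)
    then have "shift b (shift b n) = n" using x_in x unfolding map_eq_conv by force
    then show "apfst (shift b) x = x"
      using shift_fixes_if_square_fixes[OF assms(1) b] x by simp
  qed
  then show ?thesis using reduced_inverse_word_eqD[of y] eq y by (simp add: reduced_words_def)
qed

definition shift_action :: "'b \<Rightarrow> 'b word \<Rightarrow> 'b word" where
  "shift_action b = restrict (shift_word b) vertices"

lemma shift_action_Bij:
  assumes "b \<in> carrier B"
  shows "shift_action b \<in> Bij vertices"
proof -
  have "bij_betw (shift_word b) vertices vertices"
    by (rule bij_betw_byWitness[of _ "shift_word (inv b)"])
      (use assms in \<open>auto simp: shift_word_mult one_shift_word shift_word_in_vertices\<close>)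
  then show ?thesis by (simp add: shift_action_def Bij_def)
qed

lemma shift_action_hom: "shift_action \<in> hom B (BijGroup vertices)"
proof (rule homI)
  fix b c assume bc: "b \<in> carrier B" "c \<in> carrier B"
  show "shift_action (b \<otimes> c) = shift_action b \<otimes>\<^bsub>BijGroup vertices\<^esub> shift_action c"
    using bc shift_action_Bij
    by (auto simp: BijGroup_def compose_def shift_action_def fun_eq_iff shift_word_mult shift_word_in_vertices)
qed (simp add: shift_action_Bij BijGroup_def)

lemma push_Bij:
  assumes "x \<in> letters \<times> UNIV"
  shows "restrict (push x) vertices \<in> Bij vertices"
proof -
  have "flip x \<in> letters \<times> UNIV" using assms by auto
  then have "bij_betw (push x) vertices vertices"
    using assms by (intro bij_betw_byWitness[of _ "push (flip x)"]) (auto simp: push_in_reduced_words)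
  then show ?thesis by (simp add: Bij_def)
qed

end

text \<open>The universal property of the HNN extension enters through the action \<open>\<alpha>\<close> on reduced words, in which
  \<open>B\<close> permutes the letters and \<open>v\<close> multiplies by the letter \<open>1 v 1\<inverse> = v\<close>.  That no reduced word
  becomes trivial in \<open>A\<close> is a consequence of this action.\<close>

locale hnn_retract = retraction B e + A: group A + \<iota>: group_hom B A \<iota> + \<rho>: group_hom A B \<rho>
  for A :: "('a, 'd) monoid_scheme" and B :: "('b, 'c) monoid_scheme" (structure) and e \<iota> \<rho> +
  fixes v :: 'a and \<alpha> :: "'a \<Rightarrow> 'b word \<Rightarrow> 'b word"
  assumes v: "v \<in> carrier A"
    and generated: "\<lbrakk>subgroup H A; \<iota> ` carrier B \<subseteq> H; v \<in> H\<rbrakk> \<Longrightarrow> carrier A \<subseteq> H"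
    and retract: "b \<in> carrier B \<Longrightarrow> \<rho> (\<iota> b) = b"
    and stable_letter: "b \<in> carrier B \<Longrightarrow> \<iota> (e b) \<otimes>\<^bsub>A\<^esub> v = v \<otimes>\<^bsub>A\<^esub> \<iota> (e b)"
    and \<alpha>: "\<alpha> \<in> hom A (BijGroup vertices)"
    and \<alpha>_\<iota>: "\<lbrakk>b \<in> carrier B; w \<in> vertices\<rbrakk> \<Longrightarrow> \<alpha> (\<iota> b) w = shift_word b w"
    and \<alpha>_v: "w \<in> vertices \<Longrightarrow> \<alpha> v w = push (\<one>, True) w"
begin

sublocale \<alpha>: group_action A vertices \<alpha>
  by (intro group_action.intro group_hom.intro group_hom_axioms.intro A.group_axioms group_BijGroup \<alpha>)

definition letter_elt :: "'b \<times> bool \<Rightarrow> 'a" where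
  "letter_elt x = \<iota> (fst x) \<otimes>\<^bsub>A\<^esub> (if snd x then v else inv\<^bsub>A\<^esub> v) \<otimes>\<^bsub>A\<^esub> inv\<^bsub>A\<^esub> (\<iota> (fst x))"

definition word_elt :: "'b word \<Rightarrow> 'a" where
  "word_elt w = foldr (\<lambda>x y. letter_elt x \<otimes>\<^bsub>A\<^esub> y) w \<one>\<^bsub>A\<^esub>"

lemma word_elt_simps [simp]:
  "word_elt [] = \<one>\<^bsub>A\<^esub>" "word_elt (x # w) = letter_elt x \<otimes>\<^bsub>A\<^esub> word_elt w"
  by (simp_all add: word_elt_def)

lemma letter_elt_closed: "x \<in> letters \<times> UNIV \<Longrightarrow> letter_elt x \<in> carrier A"
  using v by (auto simp: letter_elt_def letters_def)

lemma word_elt_closed_words: "set w \<subseteq> letters \<times> UNIV \<Longrightarrow> word_elt w \<in> carrier A"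
  by (induction w) (auto simp: letter_elt_closed)

lemma word_elt_closed: "w \<in> vertices \<Longrightarrow> word_elt w \<in> carrier A"
  using word_elt_closed_words set_vertices by blast

lemma letter_elt_flip:
  assumes "x \<in> letters \<times> UNIV"
  shows "letter_elt (flip x) = inv\<^bsub>A\<^esub> (letter_elt x)"
  using assms v by (cases x) (auto simp: letter_elt_def letters_def A.free_reduce)

lemma word_elt_append:
  "\<lbrakk>set u \<subseteq> letters \<times> UNIV; set w \<subseteq> letters \<times> UNIV\<rbrakk>
    \<Longrightarrow> word_elt (u @ w) = word_elt u \<otimes>\<^bsub>A\<^esub> word_elt w"
  by (induction u) (auto simp: A.m_assoc letter_elt_closed word_elt_closed_words)

lemma word_elt_inverse_word:
  "set w \<subseteq> letters \<times> UNIV \<Longrightarrow> word_elt (inverse_word w) = inv\<^bsub>A\<^esub> (word_elt w)"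
proof (induction w)
  case (Cons x w)
  have "set (inverse_word w) \<subseteq> letters \<times> UNIV" "set [flip x] \<subseteq> letters \<times> UNIV"
    using Cons.prems by (auto simp: inverse_word_def)
  from word_elt_append[OF this] Cons show ?case
    by (simp add: inverse_word_def letter_elt_flip letter_elt_closed word_elt_closed_words A.inv_mult_group)
qed (simp add: inverse_word_def)

lemma word_elt_push:
  assumes "x \<in> letters \<times> UNIV" "w \<in> vertices"
  shows "word_elt (push x w) = letter_elt x \<otimes>\<^bsub>A\<^esub> word_elt w"
proof (cases "w \<noteq> [] \<and> hd w = flip x")
  case True
  then obtain w' where w: "w = flip x # w'" by (cases w) auto
  then have "w' \<in> vertices" using assms(2) by (simp add: Cons_in_reduced_words)
  then show ?thesis
    using w assms(1) by (simp add: push_def letter_elt_flip letter_elt_closed word_elt_closed A.inv_mult_cancel)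
next
  case False
  then show ?thesis by (auto simp: push_def)
qed

text \<open>The stable letter commutes with \<open>\<iota> (e b)\<close>, which is why \<open>shift b n\<close> may be divided by \<open>e b\<close>.\<close>

lemma shift_letter_elt:
  assumes b: "b \<in> carrier B" and x: "x \<in> letters \<times> UNIV"
  shows "\<iota> b \<otimes>\<^bsub>A\<^esub> letter_elt x = letter_elt (apfst (shift b) x) \<otimes>\<^bsub>A\<^esub> \<iota> b"
proof -
  obtain n c where nc: "x = (n, c)" "n \<in> carrier B" using x by (auto simp: letters_def)
  define s where "s = (if c then v else inv\<^bsub>A\<^esub> v)"
  define z where "z = \<iota> (e b)"
  have s: "s \<in> carrier A" and z: "z \<in> carrier A" using v b by (simp_all add: s_def z_def)
  have "z \<otimes>\<^bsub>A\<^esub> s = s \<otimes>\<^bsub>A\<^esub> z"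
  proof (cases c)
    case False
    have "inv\<^bsub>A\<^esub> v \<otimes>\<^bsub>A\<^esub> (z \<otimes>\<^bsub>A\<^esub> v) \<otimes>\<^bsub>A\<^esub> inv\<^bsub>A\<^esub> v = inv\<^bsub>A\<^esub> v \<otimes>\<^bsub>A\<^esub> (v \<otimes>\<^bsub>A\<^esub> z) \<otimes>\<^bsub>A\<^esub> inv\<^bsub>A\<^esub> v"
      using stable_letter[OF b] by (simp add: z_def)
    then show ?thesis using False v z by (simp add: s_def A.free_reduce)
  qed (use stable_letter[OF b] in \<open>simp add: s_def z_def\<close>)
  then have "inv\<^bsub>A\<^esub> z \<otimes>\<^bsub>A\<^esub> (s \<otimes>\<^bsub>A\<^esub> z) = s"
    using s z by (metis A.inv_mult_cancel(1))
  moreover have "letter_elt (apfst (shift b) x) \<otimes>\<^bsub>A\<^esub> \<iota> b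
      = \<iota> b \<otimes>\<^bsub>A\<^esub> \<iota> n \<otimes>\<^bsub>A\<^esub> (inv\<^bsub>A\<^esub> z \<otimes>\<^bsub>A\<^esub> (s \<otimes>\<^bsub>A\<^esub> z)) \<otimes>\<^bsub>A\<^esub> inv\<^bsub>A\<^esub> (\<iota> n)"
    using b nc(2) s z unfolding nc(1) letter_elt_def fst_apfst snd_apfst fst_conv snd_conv s_def[symmetric] shift_def
    by (simp add: z_def A.free_reduce)
  moreover have "\<iota> b \<otimes>\<^bsub>A\<^esub> letter_elt x = \<iota> b \<otimes>\<^bsub>A\<^esub> \<iota> n \<otimes>\<^bsub>A\<^esub> s \<otimes>\<^bsub>A\<^esub> inv\<^bsub>A\<^esub> (\<iota> n)"
    using b nc(2) s unfolding nc(1) letter_elt_def fst_conv snd_conv s_def[symmetric]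
    by (simp add: A.m_assoc)
  ultimately show ?thesis by simp
qed

lemma shift_word_elt:
  assumes b: "b \<in> carrier B" and w: "w \<in> vertices"
  shows "\<iota> b \<otimes>\<^bsub>A\<^esub> word_elt w = word_elt (shift_word b w) \<otimes>\<^bsub>A\<^esub> \<iota> b"
  using w
proof (induction w)
  case (Cons x w)
  have x: "x \<in> letters \<times> UNIV" and w: "w \<in> vertices" using Cons.prems by (auto simp: Cons_in_reduced_words)
  have x': "apfst (shift b) x \<in> letters \<times> UNIV" using x shift_in_letters[OF b] by auto
  note closed = letter_elt_closed[OF x] letter_elt_closed[OF x'] word_elt_closed[OF w]
    word_elt_closed[OF shift_word_in_vertices[OF b w]]
  have "\<iota> b \<otimes>\<^bsub>A\<^esub> (letter_elt x \<otimes>\<^bsub>A\<^esub> word_elt w) = letter_elt (apfst (shift b) x) \<otimes>\<^bsub>A\<^esub> (\<iota> b \<otimes>\<^bsub>A\<^esub> word_elt w)"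
    using shift_letter_elt[OF b x] closed b by (simp flip: A.m_assoc)
  then show ?case using Cons.IH[OF w] closed b by (simp add: shift_word_def A.m_assoc)
qed (use b in \<open>simp add: shift_word_def\<close>)

text \<open>The defect between \<open>g\<close> and its action on a vertex lies in the vertex group \<open>\<iota> B\<close>.\<close>

lemma mult_word_elt:
  assumes "g \<in> carrier A" "w \<in> vertices"
  shows "\<exists>b\<in>carrier B. g \<otimes>\<^bsub>A\<^esub> word_elt w = word_elt (\<alpha> g w) \<otimes>\<^bsub>A\<^esub> \<iota> b"
proof -
  let ?H = "{g \<in> carrier A. \<forall>w\<in>vertices. \<exists>b\<in>carrier B. g \<otimes>\<^bsub>A\<^esub> word_elt w = word_elt (\<alpha> g w) \<otimes>\<^bsub>A\<^esub> \<iota> b}"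
  have closed: "\<alpha> g w \<in> vertices" if "g \<in> carrier A" "w \<in> vertices" for g w
    using \<alpha>.element_image that by blast
  have "subgroup ?H A"
  proof (rule A.subgroupI)
    show "?H \<noteq> {}"
    proof -
      have "\<one>\<^bsub>A\<^esub> \<in> ?H"
      proof (intro CollectI conjI ballI bexI)
        fix w assume w: "w \<in> vertices"
        have "\<alpha> \<one>\<^bsub>A\<^esub> w = w" using \<alpha>.id_eq_one w by (metis restrict_apply')
        then show "\<one>\<^bsub>A\<^esub> \<otimes>\<^bsub>A\<^esub> word_elt w = word_elt (\<alpha> \<one>\<^bsub>A\<^esub> w) \<otimes>\<^bsub>A\<^esub> \<iota> \<one>"
          using word_elt_closed[OF w] by simp
      qed simp_all
      then show ?thesis by blast
    qed
  next
    fix g assume g: "g \<in> ?H"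
    then have gA: "g \<in> carrier A" by simp
    show "inv\<^bsub>A\<^esub> g \<in> ?H"
    proof (intro CollectI conjI ballI)
      fix w assume w: "w \<in> vertices"
      let ?w = "\<alpha> (inv\<^bsub>A\<^esub> g) w"
      have w': "?w \<in> vertices" using closed gA w by simp
      have "\<alpha> g ?w = w" using \<alpha>.orbit_sym_aux[of "inv\<^bsub>A\<^esub> g" w] gA w by simp
      with g w' obtain b where b: "b \<in> carrier B" "g \<otimes>\<^bsub>A\<^esub> word_elt ?w = word_elt w \<otimes>\<^bsub>A\<^esub> \<iota> b" by force
      have "inv\<^bsub>A\<^esub> g \<otimes>\<^bsub>A\<^esub> (g \<otimes>\<^bsub>A\<^esub> word_elt ?w) \<otimes>\<^bsub>A\<^esub> \<iota> (inv b)
          = inv\<^bsub>A\<^esub> g \<otimes>\<^bsub>A\<^esub> (word_elt w \<otimes>\<^bsub>A\<^esub> \<iota> b) \<otimes>\<^bsub>A\<^esub> \<iota> (inv b)" using b(2) by simp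
      then have "inv\<^bsub>A\<^esub> g \<otimes>\<^bsub>A\<^esub> word_elt w = word_elt ?w \<otimes>\<^bsub>A\<^esub> \<iota> (inv b)"
        using b(1) gA word_elt_closed[OF w] word_elt_closed[OF w'] by (simp add: A.free_reduce)
      then show "\<exists>b\<in>carrier B. inv\<^bsub>A\<^esub> g \<otimes>\<^bsub>A\<^esub> word_elt w = word_elt ?w \<otimes>\<^bsub>A\<^esub> \<iota> b"
        using b(1) by blast
    qed (use gA in simp)
  next
    fix g h assume g: "g \<in> ?H" and h: "h \<in> ?H"
    then have gh: "g \<in> carrier A" "h \<in> carrier A" by simp_all
    show "g \<otimes>\<^bsub>A\<^esub> h \<in> ?H"
    proof (intro CollectI conjI ballI)
      fix w assume w: "w \<in> vertices"
      have w': "\<alpha> h w \<in> vertices" "\<alpha> g (\<alpha> h w) \<in> vertices" using closed gh w by simp_all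
      obtain b where b: "b \<in> carrier B" "h \<otimes>\<^bsub>A\<^esub> word_elt w = word_elt (\<alpha> h w) \<otimes>\<^bsub>A\<^esub> \<iota> b" using h w by auto
      obtain c where c: "c \<in> carrier B" "g \<otimes>\<^bsub>A\<^esub> word_elt (\<alpha> h w) = word_elt (\<alpha> g (\<alpha> h w)) \<otimes>\<^bsub>A\<^esub> \<iota> c"
        using g w' by auto
      have "g \<otimes>\<^bsub>A\<^esub> h \<otimes>\<^bsub>A\<^esub> word_elt w = g \<otimes>\<^bsub>A\<^esub> word_elt (\<alpha> h w) \<otimes>\<^bsub>A\<^esub> \<iota> b"
        using b gh word_elt_closed w w' by (simp add: A.m_assoc)
      also have "\<dots> = word_elt (\<alpha> (g \<otimes>\<^bsub>A\<^esub> h) w) \<otimes>\<^bsub>A\<^esub> \<iota> (c \<otimes> b)"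
        using b c gh word_elt_closed w w' by (simp add: A.m_assoc \<alpha>.composition_rule)
      finally show "\<exists>b\<in>carrier B. g \<otimes>\<^bsub>A\<^esub> h \<otimes>\<^bsub>A\<^esub> word_elt w = word_elt (\<alpha> (g \<otimes>\<^bsub>A\<^esub> h) w) \<otimes>\<^bsub>A\<^esub> \<iota> b"
        using b c by blast
    qed (use gh in simp)
  qed auto
  moreover have "\<iota> ` carrier B \<subseteq> ?H"
    using shift_word_elt \<alpha>_\<iota> by auto
  moreover have "v \<in> ?H"
  proof (intro CollectI conjI ballI bexI)
    fix w assume w: "w \<in> vertices"
    have x: "(\<one>, True) \<in> letters \<times> UNIV" using one_in_letters by simp
    have "letter_elt (\<one>, True) = v" using v by (simp add: letter_elt_def)
    then show "v \<otimes>\<^bsub>A\<^esub> word_elt w = word_elt (\<alpha> v w) \<otimes>\<^bsub>A\<^esub> \<iota> \<one>"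
      using word_elt_push[OF x w] \<alpha>_v[OF w] word_elt_closed[OF w] v by simp
  qed (use v in simp_all)
  ultimately have "carrier A \<subseteq> ?H" by (rule generated)
  then show ?thesis using assms by blast
qed

lemma word_dist_action:
  assumes "g \<in> carrier A" "u \<in> vertices" "w \<in> vertices"
  shows "word_dist (\<alpha> g u) (\<alpha> g w) = word_dist u w"
proof -
  let ?H = "{g \<in> carrier A. \<forall>u\<in>vertices. \<forall>w\<in>vertices. word_dist (\<alpha> g u) (\<alpha> g w) = word_dist u w}"
  have closed: "\<alpha> g w \<in> vertices" if "g \<in> carrier A" "w \<in> vertices" for g w
    using \<alpha>.element_image that by blast
  have "subgroup ?H A"
  proof (rule A.subgroupI)
    have "\<alpha> \<one>\<^bsub>A\<^esub> w = w" if "w \<in> vertices" for w using \<alpha>.id_eq_one that by (metis restrict_apply')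
    then have "\<one>\<^bsub>A\<^esub> \<in> ?H" by simp
    then show "?H \<noteq> {}" by blast
  next
    fix g assume g: "g \<in> ?H"
    then have gA: "g \<in> carrier A" by simp
    have inv: "\<alpha> g (\<alpha> (inv\<^bsub>A\<^esub> g) w) = w" if "w \<in> vertices" for w
      using \<alpha>.orbit_sym_aux[of "inv\<^bsub>A\<^esub> g" w] gA that by simp
    show "inv\<^bsub>A\<^esub> g \<in> ?H"
    proof (intro CollectI conjI ballI)
      fix u w assume "u \<in> vertices" "w \<in> vertices"
      moreover from this have "\<alpha> (inv\<^bsub>A\<^esub> g) u \<in> vertices" "\<alpha> (inv\<^bsub>A\<^esub> g) w \<in> vertices"
        using closed gA by simp_all
      ultimately show "word_dist (\<alpha> (inv\<^bsub>A\<^esub> g) u) (\<alpha> (inv\<^bsub>A\<^esub> g) w) = word_dist u w"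
        using g inv by force
    qed (use gA in simp)
  next
    fix g h assume "g \<in> ?H" "h \<in> ?H"
    then show "g \<otimes>\<^bsub>A\<^esub> h \<in> ?H" using closed by (simp add: \<alpha>.composition_rule)
  qed auto
  moreover have "\<iota> ` carrier B \<subseteq> ?H" using \<alpha>_\<iota> word_dist_shift_word by auto
  moreover have "v \<in> ?H" using \<alpha>_v word_dist_push v by auto
  ultimately have "carrier A \<subseteq> ?H" by (rule generated)
  then show ?thesis using assms by blast
qed

lemma action_letter_elt:
  assumes x: "x \<in> letters \<times> UNIV" and w: "w \<in> vertices"
  shows "\<alpha> (letter_elt x) w = push x w"
proof -
  obtain n c where nc: "x = (n, c)" "n \<in> letters" using x by auto
  have n: "n \<in> carrier B" using nc letters_closed by simp
  let ?x = "(\<one>, c)"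
  have one: "(\<one>, d) \<in> letters \<times> UNIV" for d using one_in_letters by simp
  have s: "\<alpha> (if c then v else inv\<^bsub>A\<^esub> v) u = push ?x u" if u: "u \<in> vertices" for u
  proof (cases c)
    case False
    have u': "push (\<one>, False) u \<in> vertices" using push_in_reduced_words[OF one u] .
    have "\<alpha> v (push (\<one>, False) u) = u"
      using \<alpha>_v[OF u'] push_flip(2)[OF u, of "(\<one>, True)"] by simp
    then show ?thesis using \<alpha>.orbit_sym_aux[OF v u'] False by simp
  qed (use \<alpha>_v[OF u] in simp)
  let ?u = "shift_word (inv n) w"
  have u: "?u \<in> vertices" "push ?x ?u \<in> vertices"
    using shift_word_in_vertices n w push_in_reduced_words[OF one] by simp_all
  have "\<alpha> (letter_elt x) w = \<alpha> (\<iota> n) (\<alpha> (if c then v else inv\<^bsub>A\<^esub> v) (\<alpha> (\<iota> (inv n)) w))"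
    using n v w u \<alpha>.element_image[of "\<iota> (inv n)" w] by (simp add: letter_elt_def nc(1) \<alpha>.composition_rule)
  also have "\<dots> = shift_word n (push ?x ?u)"
    by (simp only: \<alpha>_\<iota>[OF inv_closed[OF n] w] s[OF u(1)] \<alpha>_\<iota>[OF n u(2)])
  also have "\<dots> = push x w"
    using shift_word_push[OF n u(1) one] shift_one[OF nc(2)] n w nc(1)
    by (simp add: shift_word_mult one_shift_word)
  finally show ?thesis .
qed

lemma action_word_elt: "w \<in> vertices \<Longrightarrow> \<alpha> (word_elt w) [] = w"
proof (induction w)
  case Nil
  show ?case using \<alpha>.id_eq_one by (metis Nil_in_reduced_words restrict_apply' word_elt_simps(1))
next
  case (Cons x w)
  have x: "x \<in> letters \<times> UNIV" and w: "w \<in> vertices" using Cons.prems by (auto simp: Cons_in_reduced_words)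
  then show ?case
    using Cons.IH push_Cons[OF Cons.prems] letter_elt_closed[OF x] word_elt_closed[OF w]
    by (simp add: \<alpha>.composition_rule action_letter_elt)
qed

text \<open>Suppose \<open>g\<close> interchanges the base vertex and \<open>y\<close>.  Then \<open>g\<close> is multiplication by \<open>y\<close> after some \<open>b\<close> in
  \<open>B\<close>, so that \<open>b\<close> maps the word \<open>y\<close> to its inverse.\<close>

lemma action_fixes_if_square_fixes:
  assumes roots: "no_square_commutator B" and g: "g \<in> carrier A" and w: "w \<in> vertices"
    and eq: "\<alpha> g (\<alpha> g w) = w"
  shows "\<alpha> g w = w"
proof -
  \<comment> \<open>Conjugation moves \<open>w\<close> to the base vertex.\<close>
  let ?W = "word_elt w"
  define h where "h = inv\<^bsub>A\<^esub> ?W \<otimes>\<^bsub>A\<^esub> g \<otimes>\<^bsub>A\<^esub> ?W"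
  define y where "y = \<alpha> h []"
  have W: "?W \<in> carrier A" using word_elt_closed[OF w] .
  have h: "h \<in> carrier A" using W g by (simp add: h_def)
  have closed: "\<alpha> g w \<in> vertices" if "g \<in> carrier A" "w \<in> vertices" for g w
    using \<alpha>.element_image that by blast
  have W_Nil: "\<alpha> ?W [] = w" "\<alpha> (inv\<^bsub>A\<^esub> ?W) w = []"
    using action_word_elt[OF w] \<alpha>.orbit_sym_aux[OF W Nil_in_reduced_words] by simp_all
  have W_inv: "\<alpha> ?W (\<alpha> (inv\<^bsub>A\<^esub> ?W) u) = u" if "u \<in> vertices" for u
    using \<alpha>.orbit_sym_aux[of "inv\<^bsub>A\<^esub> ?W" u] W that by simp
  have act_h: "\<alpha> h u = \<alpha> (inv\<^bsub>A\<^esub> ?W) (\<alpha> g (\<alpha> ?W u))" if "u \<in> vertices" for u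
    using that W g closed by (simp add: h_def \<alpha>.composition_rule)
  have y: "y \<in> vertices" using closed h by (simp add: y_def)
  have y_eq: "y = \<alpha> (inv\<^bsub>A\<^esub> ?W) (\<alpha> g w)" by (simp add: y_def act_h W_Nil)
  have hy: "\<alpha> h y = []" using act_h[OF y] W_inv[of "\<alpha> g w"] closed[OF g w] eq W_Nil by (simp add: y_eq)
  obtain b where b: "b \<in> carrier B" "h = word_elt y \<otimes>\<^bsub>A\<^esub> \<iota> b"
    using mult_word_elt[OF h Nil_in_reduced_words] h by (auto simp: y_def)
  have Y: "word_elt y \<in> carrier A" using word_elt_closed[OF y] .
  have "\<alpha> (word_elt y) (shift_word b y) = []"
    using hy b Y y by (simp add: \<alpha>.composition_rule \<alpha>_\<iota>)
  then have "shift_word b y = \<alpha> (inv\<^bsub>A\<^esub> (word_elt y)) []"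
    using \<alpha>.orbit_sym_aux[OF Y] shift_word_in_vertices[OF b(1) y] by metis
  also have "\<dots> = inverse_word y"
    using action_word_elt[OF inverse_word_in_reduced_words[OF y]] word_elt_inverse_word[OF set_vertices[OF y]]
    by simp
  finally have "y = []" using shift_word_inverse_eqD[OF roots b(1) y] by blast
  then show ?thesis using W_inv[of "\<alpha> g w"] closed[OF g w] W_Nil y_eq by simp
qed

text \<open>The element \<open>t\<close> fixes a vertex of the tree and so is conjugate to an element \<open>\<iota> c\<close> of the vertex group.
  The retraction \<open>\<rho>\<close> maps the relation between \<open>a\<close>, \<open>b\<close> and \<open>t\<close> to one that makes \<open>c\<^sup>2\<close> a commutator in \<open>B\<close>.\<close>

theorem no_square_commutator_hnn:
  assumes roots: "no_square_commutator B"
  shows "no_square_commutator A"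
  unfolding no_square_commutator_def
proof (intro ballI impI)
  interpret T: tree_action A vertices \<alpha> word_dist
    by (intro tree_action.intro \<alpha>.group_action_axioms tree_metric_reduced_words tree_action_axioms.intro
        word_dist_action action_fixes_if_square_fixes roots)
  fix a b t assume G: "a \<in> carrier A" "b \<in> carrier A" "t \<in> carrier A"
    and eq: "t \<otimes>\<^bsub>A\<^esub> t = a \<otimes>\<^bsub>A\<^esub> b \<otimes>\<^bsub>A\<^esub> inv\<^bsub>A\<^esub> a \<otimes>\<^bsub>A\<^esub> inv\<^bsub>A\<^esub> b"
  obtain w where w: "w \<in> vertices" "\<alpha> t w = w"
    using T.square_commutator_fixes_point[OF G eq] Nil_in_reduced_words by blast
  let ?W = "word_elt w"
  have W: "?W \<in> carrier A" using word_elt_closed[OF w(1)] .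
  obtain c where c: "c \<in> carrier B" "t \<otimes>\<^bsub>A\<^esub> ?W = ?W \<otimes>\<^bsub>A\<^esub> \<iota> c"
    using mult_word_elt[OF G(3) w(1)] w(2) by auto
  have "\<iota> c = inv\<^bsub>A\<^esub> ?W \<otimes>\<^bsub>A\<^esub> (t \<otimes>\<^bsub>A\<^esub> ?W)" unfolding c(2) using c(1) W by (simp add: A.free_reduce)
  then have "\<rho> (\<iota> c) = \<rho> (inv\<^bsub>A\<^esub> ?W \<otimes>\<^bsub>A\<^esub> (t \<otimes>\<^bsub>A\<^esub> ?W))" by simp
  then have c_eq: "c = inv (\<rho> ?W) \<otimes> (\<rho> t \<otimes> \<rho> ?W)" using retract[OF c(1)] W G by simp
  let ?conj = "\<lambda>g. inv (\<rho> ?W) \<otimes> (\<rho> g \<otimes> \<rho> ?W)"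
  have "c \<otimes> c = inv (\<rho> ?W) \<otimes> \<rho> (t \<otimes>\<^bsub>A\<^esub> t) \<otimes> \<rho> ?W"
    unfolding c_eq using G W by (simp add: free_reduce)
  also have "\<dots> = ?conj a \<otimes> ?conj b \<otimes> inv (?conj a) \<otimes> inv (?conj b)"
    unfolding eq using G W by (simp add: free_reduce)
  finally have "c \<otimes> c = ?conj a \<otimes> ?conj b \<otimes> inv (?conj a) \<otimes> inv (?conj b)" .
  moreover have "?conj a \<in> carrier B" "?conj b \<in> carrier B" using G W by simp_all
  ultimately have "c = \<one>"
    using roots c(1) unfolding no_square_commutator_def by blast
  then show "t = \<one>\<^bsub>A\<^esub>" using c(2) W G by (simp add: A.r_cancel_one)
qed

end

section \<open>Presented groups\<close>

definition generator :: "'s set \<Rightarrow> ('s word \<times> 's word) set \<Rightarrow> 's \<Rightarrow> 's word set" where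
  "generator S R s = word_eq S R `` {[(s, True)]}"

lemma class_in_presented_group: "w \<in> words S \<Longrightarrow> word_eq S R `` {w} \<in> carrier (presented_group S R)"
  by (simp add: presented_group_def quotientI)

lemma generator_closed: "s \<in> S \<Longrightarrow> generator S R s \<in> carrier (presented_group S R)"
  unfolding generator_def by (rule class_in_presented_group) simp

lemma presented_group_one: "\<one>\<^bsub>presented_group S R\<^esub> = word_eq S R `` {[]}"
  by (simp add: presented_group_def)

lemma inv_generator:
  assumes "s \<in> S"
  shows "inv\<^bsub>presented_group S R\<^esub> (generator S R s) = word_eq S R `` {[(s, False)]}"
proof (rule group.inv_equality[OF group_presented_group])
  have "([(s, False), (s, True)], []) \<in> word_eq S R" using word_eq_cancel[OF assms, of False] by simp
  then show "word_eq S R `` {[(s, False)]} \<otimes>\<^bsub>presented_group S R\<^esub> generator S R s = \<one>\<^bsub>presented_group S R\<^esub>"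
    unfolding generator_def presented_group_one
    using assms presented_group_mult[of "[(s, False)]" S "[(s, True)]" R] equiv_class_eq[OF equiv_word_eq]
    by simp
qed (use assms class_in_presented_group[of "[(s, False)]" S R] generator_closed in auto)

lemma presented_group_generated:
  assumes "subgroup H (presented_group S R)" and "\<And>s. s \<in> S \<Longrightarrow> generator S R s \<in> H"
  shows "carrier (presented_group S R) \<subseteq> H"
proof
  interpret H: subgroup H "presented_group S R" by fact
  have "word_eq S R `` {w} \<in> H" if "w \<in> words S" for w
    using that
  proof (induction w)
    case Nil
    show ?case using H.one_closed by (simp add: presented_group_one)
  next
    case (Cons x w)
    obtain s c where x: "x = (s, c)" by (cases x)
    have s: "s \<in> S" and w: "w \<in> words S" using Cons.hyps x by auto
    have "word_eq S R `` {[(s, True)]} \<in> H" "word_eq S R `` {[(s, False)]} \<in> H"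
      using assms(2)[OF s] H.m_inv_closed[OF assms(2)[OF s]]
      by (simp_all only: inv_generator[OF s]) (simp add: generator_def)
    then have "word_eq S R `` {[x]} \<in> H" using x by (cases c) simp_all
    from H.m_closed[OF this Cons.IH] show ?case
      using presented_group_mult[of "[x]" S w R] s w x by simp
  qed
  fix X assume "X \<in> carrier (presented_group S R)"
  then show "X \<in> H"
    using \<open>\<And>w. w \<in> words S \<Longrightarrow> word_eq S R `` {w} \<in> H\<close>
    by (auto simp: presented_group_def elim!: quotientE)
qed

lemma presented_group_hom_eqI:
  assumes "group H" "f \<in> hom (presented_group S R) H" "g \<in> hom (presented_group S R) H"
    and eq: "\<And>s. s \<in> S \<Longrightarrow> f (generator S R s) = g (generator S R s)"
    and "x \<in> carrier (presented_group S R)"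
  shows "f x = g x"
proof -
  let ?P = "presented_group S R"
  interpret P: group ?P by (rule group_presented_group)
  interpret f: group_hom ?P H f using assms by (simp add: group_hom_def group_hom_axioms_def P.group_axioms)
  interpret g: group_hom ?P H g using assms by (simp add: group_hom_def group_hom_axioms_def P.group_axioms)
  have "subgroup {x \<in> carrier ?P. f x = g x} ?P"
    by (rule P.subgroupI) (auto intro: exI[of _ "\<one>\<^bsub>?P\<^esub>"])
  then have "carrier ?P \<subseteq> {x \<in> carrier ?P. f x = g x}"
    by (rule presented_group_generated) (use eq generator_closed in auto)
  then show ?thesis using assms by blast
qed

definition evaluate :: "('g, 'h) monoid_scheme \<Rightarrow> ('s \<Rightarrow> 'g) \<Rightarrow> 's word \<Rightarrow> 'g" where
  "evaluate H f w = foldr (\<lambda>(s, c) y. (if c then f s else inv\<^bsub>H\<^esub> (f s)) \<otimes>\<^bsub>H\<^esub> y) w \<one>\<^bsub>H\<^esub>"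

text \<open>Von Dyck's theorem: a map on the generators that respects the relations extends because word
  equality is the least congruence with the defining identities.\<close>

lemma presented_group_lift:
  assumes "group H" and f: "\<And>s. s \<in> S \<Longrightarrow> f s \<in> carrier H"
    and rel: "\<And>l r. \<lbrakk>(l, r) \<in> R; l \<in> words S; r \<in> words S\<rbrakk> \<Longrightarrow> evaluate H f l = evaluate H f r"
  obtains h where "h \<in> hom (presented_group S R) H" "\<And>s. s \<in> S \<Longrightarrow> h (generator S R s) = f s"
proof -
  interpret H: group H by fact
  let ?ev = "evaluate H f"
  have ev_simps: "?ev [] = \<one>\<^bsub>H\<^esub>"
    "?ev ((s, c) # w) = (if c then f s else inv\<^bsub>H\<^esub> (f s)) \<otimes>\<^bsub>H\<^esub> ?ev w" for s c w
    by (simp_all add: evaluate_def)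
  have closed: "?ev w \<in> carrier H" if "w \<in> words S" for w
    using that f by (induction w) (auto simp: ev_simps)
  have append: "?ev (u @ w) = ?ev u \<otimes>\<^bsub>H\<^esub> ?ev w" if "u \<in> words S" "w \<in> words S" for u w
    using that(1)
  proof (induction u)
    case (Cons x u)
    then show ?case
      using f closed[OF that(2)] closed[of u] by (cases x) (auto simp: ev_simps H.m_assoc)
  qed (use closed that in \<open>simp add: ev_simps\<close>)
  have respects: "?ev u = ?ev w" if "(u, w) \<in> word_eq S R" for u w
    using that
  proof induction
    case (word_eq_append u u' v v')
    then show ?case using append word_eq_words[OF word_eq_append.hyps(1)] word_eq_words[OF word_eq_append.hyps(2)]
      by simp
  next
    case (word_eq_cancel s b)
    then show ?case using f by (cases b) (simp_all add: ev_simps)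
  next
    case (word_eq_relation l r)
    then show ?case using rel by blast
  qed simp_all
  define h where "h X = ?ev (SOME w. w \<in> X)" for X
  have h_class: "h (word_eq S R `` {w}) = ?ev w" if "w \<in> words S" for w
  proof -
    have "w \<in> word_eq S R `` {w}" using word_eq_refl[OF that] by simp
    then have "(w, SOME u. u \<in> word_eq S R `` {w}) \<in> word_eq S R" by (metis Image_singleton_iff someI)
    then show ?thesis unfolding h_def using respects by simp
  qed
  have "h \<in> hom (presented_group S R) H"
  proof (rule homI)
    fix X assume "X \<in> carrier (presented_group S R)"
    then obtain u where u: "u \<in> words S" "X = word_eq S R `` {u}"
      by (auto simp: presented_group_def elim!: quotientE)
    then show "h X \<in> carrier H" using h_class closed by simp
    fix Y assume "Y \<in> carrier (presented_group S R)"
    then obtain w where w: "w \<in> words S" "Y = word_eq S R `` {w}"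
      by (auto simp: presented_group_def elim!: quotientE)
    have "u @ w \<in> words S" using u w by simp
    then show "h (X \<otimes>\<^bsub>presented_group S R\<^esub> Y) = h X \<otimes>\<^bsub>H\<^esub> h Y"
      using u w by (simp add: presented_group_mult h_class append)
  qed
  moreover have "h (generator S R s) = f s" if "s \<in> S" for s
    using that f by (simp add: generator_def h_class ev_simps)
  ultimately show thesis by (rule that)
qed

section \<open>Right-angled Artin groups\<close>

abbreviation commutations :: "('v \<times> 'v) set \<Rightarrow> ('v word \<times> 'v word) set" where
  "commutations E \<equiv> {([(u, True), (v, True)], [(v, True), (u, True)]) | u v. (u, v) \<in> E}"

text \<open>The relations between vertices outside \<open>V\<close> are void, so that the same edge set \<open>E\<close> serves all
  subsets \<open>V\<close> of the vertices.\<close>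

abbreviation raag :: "('v \<times> 'v) set \<Rightarrow> 'v set \<Rightarrow> 'v word set monoid" where
  "raag E V \<equiv> presented_group V (commutations E)"

abbreviation vertex :: "('v \<times> 'v) set \<Rightarrow> 'v set \<Rightarrow> 'v \<Rightarrow> 'v word set" where
  "vertex E V \<equiv> generator V (commutations E)"

lemma vertices_commute:
  assumes "(u, v) \<in> E \<or> (v, u) \<in> E" "u \<in> V" "v \<in> V"
  shows "vertex E V u \<otimes>\<^bsub>raag E V\<^esub> vertex E V v = vertex E V v \<otimes>\<^bsub>raag E V\<^esub> vertex E V u"
proof -
  have *: "vertex E V u \<otimes>\<^bsub>raag E V\<^esub> vertex E V v = vertex E V v \<otimes>\<^bsub>raag E V\<^esub> vertex E V u"
    if "(u, v) \<in> E" "u \<in> V" "v \<in> V" for u v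
  proof -
    have "([(u, True), (v, True)], [(v, True), (u, True)]) \<in> word_eq V (commutations E)"
      using that by (intro word_eq_relation) auto
    then show ?thesis
      unfolding generator_def using that equiv_class_eq[OF equiv_word_eq] by (simp add: presented_group_mult)
  qed
  show ?thesis using assms *[of u v] *[of v u] by auto
qed

lemma raag_lift:
  assumes "group H" and f: "\<And>s. s \<in> V \<Longrightarrow> f s \<in> carrier H"
    and comm: "\<And>s t. \<lbrakk>(s, t) \<in> E; s \<in> V; t \<in> V\<rbrakk> \<Longrightarrow> f s \<otimes>\<^bsub>H\<^esub> f t = f t \<otimes>\<^bsub>H\<^esub> f s"
  obtains h where "h \<in> hom (raag E V) H" "\<And>s. s \<in> V \<Longrightarrow> h (vertex E V s) = f s"
proof -
  interpret H: group H by fact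
  show thesis
  proof (rule presented_group_lift[OF \<open>group H\<close>, of V f "commutations E"])
    fix l r assume "(l, r) \<in> commutations E" "l \<in> words V" "r \<in> words V"
    then obtain s t where "l = [(s, True), (t, True)]" "r = [(t, True), (s, True)]" "(s, t) \<in> E" "s \<in> V" "t \<in> V"
      by auto
    then show "evaluate H f l = evaluate H f r" using f comm by (simp add: evaluate_def)
  qed (use f that in auto)
qed

text \<open>The homomorphisms of the HNN extension are given on the vertices: \<open>e\<close> kills the vertices of \<open>V\<close> that are
  not adjacent to \<open>v\<close>, \<open>\<rho>\<close> kills \<open>v\<close>, and \<open>\<alpha>\<close> respects the relations between \<open>v\<close> and its neighbours \<open>s\<close>
  because \<open>s 1 (e s)\<inverse> = 1\<close>, that is, \<open>s\<close> fixes the letter \<open>v\<close>.\<close>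

lemma no_square_commutator_insert:
  assumes roots: "no_square_commutator (raag E V)" and "v \<notin> V"
  shows "no_square_commutator (raag E (insert v V))"
proof -
  let ?W = "insert v V"
  let ?A = "raag E ?W" and ?B = "raag E V"
  let ?x = "vertex E ?W" and ?y = "vertex E V"
  interpret A: group ?A by (rule group_presented_group)
  interpret B: group ?B by (rule group_presented_group)
  define L where "L = {s \<in> V. (v, s) \<in> E \<or> (s, v) \<in> E}"
  have x: "?x s \<in> carrier ?A" if "s \<in> ?W" for s using that by (rule generator_closed)
  have y: "?y s \<in> carrier ?B" if "s \<in> V" for s using that by (rule generator_closed)
  obtain e where e: "e \<in> hom ?B ?B" "\<And>s. s \<in> V \<Longrightarrow> e (?y s) = (if s \<in> L then ?y s else \<one>\<^bsub>?B\<^esub>)"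
  proof (rule raag_lift[OF B.group_axioms, of V "\<lambda>s. if s \<in> L then ?y s else \<one>\<^bsub>?B\<^esub>" E])
    fix s t assume "(s, t) \<in> E" "s \<in> V" "t \<in> V"
    then show "(if s \<in> L then ?y s else \<one>\<^bsub>?B\<^esub>) \<otimes>\<^bsub>?B\<^esub> (if t \<in> L then ?y t else \<one>\<^bsub>?B\<^esub>) =
      (if t \<in> L then ?y t else \<one>\<^bsub>?B\<^esub>) \<otimes>\<^bsub>?B\<^esub> (if s \<in> L then ?y s else \<one>\<^bsub>?B\<^esub>)"
      using vertices_commute[of s t E V] y[of s] y[of t] by simp
  qed (use y in auto)
  obtain \<iota> where \<iota>: "\<iota> \<in> hom ?B ?A" "\<And>s. s \<in> V \<Longrightarrow> \<iota> (?y s) = ?x s"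
  proof (rule raag_lift[OF A.group_axioms, of V ?x E])
    fix s t assume "(s, t) \<in> E" "s \<in> V" "t \<in> V"
    then show "?x s \<otimes>\<^bsub>?A\<^esub> ?x t = ?x t \<otimes>\<^bsub>?A\<^esub> ?x s" by (intro vertices_commute) auto
  qed (use x in auto)
  obtain \<rho> where \<rho>: "\<rho> \<in> hom ?A ?B" "\<And>s. s \<in> ?W \<Longrightarrow> \<rho> (?x s) = (if s = v then \<one>\<^bsub>?B\<^esub> else ?y s)"
  proof (rule raag_lift[OF B.group_axioms, of ?W "\<lambda>s. if s = v then \<one>\<^bsub>?B\<^esub> else ?y s" E])
    fix s t assume "(s, t) \<in> E" "s \<in> ?W" "t \<in> ?W"
    then show "(if s = v then \<one>\<^bsub>?B\<^esub> else ?y s) \<otimes>\<^bsub>?B\<^esub> (if t = v then \<one>\<^bsub>?B\<^esub> else ?y t) =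
      (if t = v then \<one>\<^bsub>?B\<^esub> else ?y t) \<otimes>\<^bsub>?B\<^esub> (if s = v then \<one>\<^bsub>?B\<^esub> else ?y s)"
      using vertices_commute[of s t E V] y[of s] y[of t] by auto
  qed (use y in auto)
  interpret e: group_hom ?B ?B e by unfold_locales (rule e)
  interpret \<iota>: group_hom ?B ?A \<iota> by unfold_locales (rule \<iota>)
  interpret \<rho>: group_hom ?A ?B \<rho> by unfold_locales (rule \<rho>)
  interpret R: retraction ?B e
  proof unfold_locales
    fix b assume b: "b \<in> carrier ?B"
    have "e \<circ> e \<in> hom ?B ?B" using e(1) by (simp add: hom_def Pi_def)
    then have "(e \<circ> e) b = e b"
    proof (rule presented_group_hom_eqI[OF B.group_axioms _ e(1) _ b])
      fix s assume "s \<in> V"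
      then show "(e \<circ> e) (?y s) = e (?y s)" by (simp add: e(2))
    qed
    show "e (e b) = e b" using \<open>(e \<circ> e) b = e b\<close> by simp
  qed
  let ?T = "reduced_words R.letters"
  define push_one where "push_one = restrict (push (\<one>\<^bsub>?B\<^esub>, True)) ?T"
  have one: "(\<one>\<^bsub>?B\<^esub>, True) \<in> R.letters \<times> UNIV" using R.one_in_letters by simp
  have push_one: "push_one \<in> carrier (BijGroup ?T)"
    using R.push_Bij[OF one] by (simp add: push_one_def BijGroup_def)
  have shift: "R.shift_action b \<in> carrier (BijGroup ?T)" if "b \<in> carrier ?B" for b
    using R.shift_action_Bij[OF that] by (simp add: BijGroup_def)
  have shift_push: "R.shift_action (?y s) \<otimes>\<^bsub>BijGroup ?T\<^esub> push_one = push_one \<otimes>\<^bsub>BijGroup ?T\<^esub> R.shift_action (?y s)"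
    if "s \<in> L" for s
  proof -
    have s: "s \<in> V" "?y s \<in> carrier ?B" "e (?y s) = ?y s" using that y e(2) by (auto simp: L_def)
    then have "R.shift (?y s) \<one>\<^bsub>?B\<^esub> = \<one>\<^bsub>?B\<^esub>" by (simp add: R.shift_def)
    then have "R.shift_word (?y s) (push (\<one>\<^bsub>?B\<^esub>, True) w) = push (\<one>\<^bsub>?B\<^esub>, True) (R.shift_word (?y s) w)"
      if "w \<in> ?T" for w using R.shift_word_push[OF s(2) that one] by simp
    then show ?thesis
      using push_one shift[OF s(2)] push_in_reduced_words[OF one] R.shift_word_in_vertices[OF s(2)]
      by (auto simp: BijGroup_def compose_def push_one_def R.shift_action_def fun_eq_iff)
  qed
  obtain \<alpha> where \<alpha>: "\<alpha> \<in> hom ?A (BijGroup ?T)"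
    "\<And>s. s \<in> ?W \<Longrightarrow> \<alpha> (?x s) = (if s = v then push_one else R.shift_action (?y s))"
  proof (rule raag_lift[OF group_BijGroup, of ?W "\<lambda>s. if s = v then push_one else R.shift_action (?y s)" ?T E])
    fix s t assume st: "(s, t) \<in> E" "s \<in> ?W" "t \<in> ?W"
    have "R.shift_action (?y s) \<otimes>\<^bsub>BijGroup ?T\<^esub> R.shift_action (?y t) = R.shift_action (?y t) \<otimes>\<^bsub>BijGroup ?T\<^esub> R.shift_action (?y s)"
      if "s \<in> V" "t \<in> V"
      using hom_mult[OF R.shift_action_hom, of "?y s" "?y t"] hom_mult[OF R.shift_action_hom, of "?y t" "?y s"]
        vertices_commute[of s t E V] st that y by simp
    then show "(if s = v then push_one else R.shift_action (?y s)) \<otimes>\<^bsub>BijGroup ?T\<^esub>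
        (if t = v then push_one else R.shift_action (?y t)) =
      (if t = v then push_one else R.shift_action (?y t)) \<otimes>\<^bsub>BijGroup ?T\<^esub>
        (if s = v then push_one else R.shift_action (?y s))"
      using st shift_push[of s] shift_push[of t] by (auto simp: L_def)
  qed (use push_one shift y in auto)
  interpret hnn_retract ?A ?B e \<iota> \<rho> "?x v" \<alpha>
  proof unfold_locales
    show "?x v \<in> carrier ?A" using x by simp
  next
    fix H assume H: "subgroup H ?A" "\<iota> ` carrier ?B \<subseteq> H" "?x v \<in> H"
    show "carrier ?A \<subseteq> H"
    proof (rule presented_group_generated[OF H(1)])
      fix s assume "s \<in> ?W"
      moreover have "?x s \<in> H" if "s \<in> V" 
        using subsetD[OF H(2) imageI[OF y[OF that]]] by (simp only: \<iota>(2)[OF that])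
      ultimately show "?x s \<in> H" using H(3) by auto
    qed
  next
    fix b assume b: "b \<in> carrier ?B"
    have "\<rho> \<circ> \<iota> \<in> hom ?B ?B" using \<iota>(1) \<rho>(1) by (simp add: hom_def Pi_def)
    moreover have "id \<in> hom ?B ?B" by (simp add: hom_def)
    ultimately have "(\<rho> \<circ> \<iota>) b = id b"
    proof (rule presented_group_hom_eqI[OF B.group_axioms _ _ _ b])
      fix s assume "s \<in> V"
      then show "(\<rho> \<circ> \<iota>) (?y s) = id (?y s)" using \<open>v \<notin> V\<close> by (auto simp: \<iota>(2) \<rho>(2))
    qed
    then show "\<rho> (\<iota> b) = b" by simp
    have xv: "?x v \<in> carrier ?A" using x by simp
    define C where "C = {g \<in> carrier ?A. g \<otimes>\<^bsub>?A\<^esub> ?x v = ?x v \<otimes>\<^bsub>?A\<^esub> g}"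
    interpret C: subgroup C ?A unfolding C_def by (rule A.subgroup_commuting[OF xv])
    let ?H = "{b \<in> carrier ?B. \<iota> (e b) \<in> C}"
    have "subgroup ?H ?B"
    proof (rule B.subgroupI)
      have "\<one>\<^bsub>?B\<^esub> \<in> ?H" by simp
      then show "?H \<noteq> {}" by blast
    qed auto
    then have "carrier ?B \<subseteq> ?H"
    proof (rule presented_group_generated)
      fix s assume s: "s \<in> V"
      have "\<iota> (e (?y s)) \<in> C"
      proof (cases "s \<in> L")
        case True
        then have "?x s \<otimes>\<^bsub>?A\<^esub> ?x v = ?x v \<otimes>\<^bsub>?A\<^esub> ?x s"
          using s by (intro vertices_commute) (auto simp: L_def)
        then have "?x s \<in> C" unfolding C_def using x s by blast
        then show ?thesis using True s by (simp add: e(2) \<iota>(2))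
      qed (use s in \<open>simp add: e(2)\<close>)
      then show "?y s \<in> ?H" using y[OF s] by blast
    qed
    then show "\<iota> (e b) \<otimes>\<^bsub>?A\<^esub> ?x v = ?x v \<otimes>\<^bsub>?A\<^esub> \<iota> (e b)" using b unfolding C_def by blast
    fix w assume w: "w \<in> ?T"
    have "\<alpha> \<circ> \<iota> \<in> hom ?B (BijGroup ?T)" using \<iota>(1) \<alpha>(1) by (simp add: hom_def Pi_def)
    then have "(\<alpha> \<circ> \<iota>) b = R.shift_action b"
    proof (rule presented_group_hom_eqI[OF group_BijGroup _ R.shift_action_hom _ b])
      fix s assume "s \<in> V"
      then show "(\<alpha> \<circ> \<iota>) (?y s) = R.shift_action (?y s)" using \<open>v \<notin> V\<close> by (auto simp: \<iota>(2) \<alpha>(2))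
    qed
    then show "\<alpha> (\<iota> b) w = R.shift_word b w" using w by (simp add: R.shift_action_def)
  next
    show "\<alpha> \<in> hom ?A (BijGroup ?T)" by (rule \<alpha>(1))
  next
    fix w assume "w \<in> ?T"
    then show "\<alpha> (?x v) w = push (\<one>\<^bsub>?B\<^esub>, True) w" using \<alpha>(2)[of v] by (simp add: push_one_def)
  qed
  show ?thesis using no_square_commutator_hnn[OF roots] .
qed

theorem no_square_commutator_raag: "finite V \<Longrightarrow> no_square_commutator (raag E V)"
proof (induction V rule: finite_induct)
  case empty
  have "carrier (raag E {}) \<subseteq> {\<one>\<^bsub>raag E {}\<^esub>}"
    by (rule presented_group_generated) (auto intro: group.triv_subgroup group_presented_group)
  then show ?case unfolding no_square_commutator_def by blast
qed (rule no_square_commutator_insert)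

theorem theorem7:
  fixes A :: "('a, 'b) monoid_scheme" and \<Delta> :: "'v pair_pre_digraph" and x y z :: 'a
  assumes "pair_graph \<Delta>" and "group A" and "A \<cong> RAAG \<Delta>"
    and "x \<in> carrier A" and "y \<in> carrier A" and "z \<in> carrier A"
    and "x [^]\<^bsub>A\<^esub> (2::nat) \<otimes>\<^bsub>A\<^esub> y [^]\<^bsub>A\<^esub> (2::nat) = z [^]\<^bsub>A\<^esub> (2::nat)"
  shows "x \<otimes>\<^bsub>A\<^esub> y = y \<otimes>\<^bsub>A\<^esub> x \<and> x \<otimes>\<^bsub>A\<^esub> z = z \<otimes>\<^bsub>A\<^esub> x \<and> y \<otimes>\<^bsub>A\<^esub> z = z \<otimes>\<^bsub>A\<^esub> y"
proof -
  let ?R = "raag (parcs \<Delta>) (pverts \<Delta>)"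
  interpret A: group A by fact
  interpret R: group ?R by (rule group_presented_group)
  interpret \<Delta>: pair_graph \<Delta> by fact
  have "finite (pverts \<Delta>)" by (rule \<Delta>.pair_finite_verts)
  then have roots: "no_square_commutator ?R" by (rule no_square_commutator_raag)
  obtain h where h: "h \<in> iso A ?R" using assms(3) unfolding is_iso_def RAAG_def by blast
  interpret h: group_hom A ?R h
    by unfold_locales (use h in \<open>simp add: iso_def\<close>)
  have inj: "inj_on h (carrier A)" using h by (simp add: iso_def bij_betw_def)
  have "(x \<otimes>\<^bsub>A\<^esub> x) \<otimes>\<^bsub>A\<^esub> (y \<otimes>\<^bsub>A\<^esub> y) = z \<otimes>\<^bsub>A\<^esub> z"
    using assms(4-7) by (simp add: numeral_2_eq_2)
  then have "h ((x \<otimes>\<^bsub>A\<^esub> x) \<otimes>\<^bsub>A\<^esub> (y \<otimes>\<^bsub>A\<^esub> y)) = h (z \<otimes>\<^bsub>A\<^esub> z)" by simp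
  then have "(h x \<otimes>\<^bsub>?R\<^esub> h x) \<otimes>\<^bsub>?R\<^esub> (h y \<otimes>\<^bsub>?R\<^esub> h y) = h z \<otimes>\<^bsub>?R\<^esub> h z"
    using assms(4-6) by simp
  from R.squares_commute[OF roots _ _ _ this]
  have "h (x \<otimes>\<^bsub>A\<^esub> y) = h (y \<otimes>\<^bsub>A\<^esub> x)" "h (x \<otimes>\<^bsub>A\<^esub> z) = h (z \<otimes>\<^bsub>A\<^esub> x)" "h (y \<otimes>\<^bsub>A\<^esub> z) = h (z \<otimes>\<^bsub>A\<^esub> y)"
    using assms(4-6) by simp_all
  then show ?thesis using inj_onD[OF inj] assms(4-6) by simp
qed

end
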